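(* Let $G$ be an Abelian group (written multiplicatively), $R$ a commutative ring with unity, $\varphi:\mathbb{Z}^d\to G$ a homomorphism, and $P\subset\mathbb{R}^d$ a rational polytope. Then, as rational functions in $z_1,\dots,z_d$ with coefficients in $R[G]$, $$\sigma(P,\varphi;\mathbf z)=\sum_{v\text{ vertex of }P}\sigma(K_{v,P},\varphi;\mathbf z).$$
   Context: $R[G]$ is the group ring. For a rational polyhedron $Q\subset\mathbb{R}^d$, $\sigma(Q,\varphi;\mathbf z)=\sum_{\alpha\in Q\cap\mathbb{Z}^d}\varphi(\alpha)\mathbf z^{\alpha}$, where $\mathbf z^\alpha=z_1^{\alpha_1}\cdots z_d^{\alpha_d}$. For a vertex $v$ of $P$, the vertex cone is $K_{v,P}=\{v+\lambda(u-v):u\in P,\ \lambda\ge0\}$. The $\varphi$-integer point transform of each such (pointed, rational) cone is identified with a rational function, i.e., an element of the localization of $R[G][z_1^{\pm1},\dots,z_d^{\pm1}]$ at the elements $1-\varphi(u)\mathbf z^{u}$, $u\in\mathbb{Z}^d$ (via decomposition into half-open simplicial cones, each of whose transforms has the form $\big(\sum_{\alpha\in\Pi\cap\mathbb Z^d}\varphi(\alpha)\mathbf z^\alpha\big)/\prod_i(1-\varphi(u_i)\mathbf z^{u_i})$ with $u_i$ integer generators and $\Pi$ the corresponding fundamental parallelepiped); $\sigma(P,\varphi;\mathbf z)$ is a Laurent polynomial since $P$ is bounded. *)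

theory Defs
  imports "HOL-Analysis.Analysis" "HOL-Algebra.Ring" "HOL-Library.Poly_Mapping"
begin

section \<open>Localization of a commutative ring\<close>

definition loc_rel :: "'a::comm_ring_1 set \<Rightarrow> (('a \<times> 'a) \<times> ('a \<times> 'a)) set" where
  "loc_rel S = {((a, s), (b, t)) | a s b t. s \<in> S \<and> t \<in> S \<and> (\<exists>w\<in>S. w * (a * t - b * s) = 0)}"

definition loc_frac :: "'a::comm_ring_1 set \<Rightarrow> 'a \<Rightarrow> 'a \<Rightarrow> ('a \<times> 'a) set" where
  "loc_frac S a s = loc_rel S `` {(a, s)}"

definition localization :: "'a::comm_ring_1 set \<Rightarrow> ('a \<times> 'a) set ring" where
  "localization S =
    \<lparr>carrier = (UNIV \<times> S) // loc_rel S,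
     mult = (\<lambda>x y. \<Union>(a, s)\<in>x. \<Union>(b, t)\<in>y. loc_frac S (a * b) (s * t)),
     one = loc_frac S 1 1,
     zero = loc_frac S 0 1,
     add = (\<lambda>x y. \<Union>(a, s)\<in>x. \<Union>(b, t)\<in>y. loc_frac S (a * t + b * s) (s * t))\<rparr>"

lemma UN2_const:
  assumes "x \<in> X" "y \<in> Y"
    and "\<And>a s b t. (a, s) \<in> X \<Longrightarrow> (b, t) \<in> Y \<Longrightarrow> F a s b t = C"
  shows "(\<Union>(a, s)\<in>X. \<Union>(b, t)\<in>Y. F a s b t) = C"
proof -
  have "(\<Union>(a, s)\<in>X. \<Union>(b, t)\<in>Y. F a s b t) = (\<Union>p\<in>X. \<Union>q\<in>Y. C)"
    by (intro SUP_cong refl) (use assms(3) in \<open>auto intro!: SUP_cong\<close>)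
  also have "\<dots> = C" using assms(1,2) by auto
  finally show ?thesis .
qed

locale mult_submonoid =
  fixes S :: "'a::comm_ring_1 set"
  assumes one_mem: "1 \<in> S"
    and mult_mem: "s \<in> S \<Longrightarrow> t \<in> S \<Longrightarrow> s * t \<in> S"
begin

lemma equiv_loc_rel: "equiv (UNIV \<times> S) (loc_rel S)"
proof (rule equivI)
  show "loc_rel S \<subseteq> (UNIV \<times> S) \<times> (UNIV \<times> S)"
    by (auto simp: loc_rel_def)
  show "refl_on (UNIV \<times> S) (loc_rel S)"
    using one_mem by (force simp: refl_on_def loc_rel_def)
  show "sym (loc_rel S)"
  proof (rule symI)
    fix x y assume "(x, y) \<in> loc_rel S"
    then obtain a s b t w where *: "x = (a, s)" "y = (b, t)" "s \<in> S" "t \<in> S" "w \<in> S"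
      "w * (a * t - b * s) = 0" by (auto simp: loc_rel_def)
    have "w * (b * s - a * t) = - (w * (a * t - b * s))" by (simp add: algebra_simps)
    with * show "(y, x) \<in> loc_rel S" by (auto simp: loc_rel_def)
  qed
  show "trans (loc_rel S)"
  proof (rule transI)
    fix x y z assume "(x, y) \<in> loc_rel S" "(y, z) \<in> loc_rel S"
    then obtain a s b t c r w w' where *: "x = (a, s)" "y = (b, t)" "z = (c, r)"
      "s \<in> S" "t \<in> S" "r \<in> S" "w \<in> S" "w' \<in> S"
      "w * (a * t - b * s) = 0" "w' * (b * r - c * t) = 0"
      by (auto simp: loc_rel_def)
    have "(w * w' * t) * (a * r - c * s)
        = w' * r * (w * (a * t - b * s)) + w * s * (w' * (b * r - c * t))"
      by (simp add: algebra_simps)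
    also have "\<dots> = 0" using * by simp
    finally have "(w * w' * t) * (a * r - c * s) = 0" .
    moreover have "w * w' * t \<in> S" using * mult_mem by blast
    ultimately show "(x, z) \<in> loc_rel S" using * by (auto simp: loc_rel_def)
  qed
qed

lemma loc_frac_eq_iff:
  assumes "s \<in> S" "t \<in> S"
  shows "loc_frac S a s = loc_frac S b t \<longleftrightarrow> (\<exists>w\<in>S. w * (a * t - b * s) = 0)"
  using eq_equiv_class_iff[OF equiv_loc_rel, of "(a, s)" "(b, t)"] assms
  by (simp add: loc_frac_def loc_rel_def)

lemma carrier_localization: "carrier (localization S) = {loc_frac S a s | a s. s \<in> S}"
  by (auto simp: localization_def quotient_def loc_frac_def)

lemma loc_frac_self: "s \<in> S \<Longrightarrow> (a, s) \<in> loc_frac S a s"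
  using one_mem by (auto simp: loc_frac_def loc_rel_def)

lemma loc_frac_mem: "(b, t) \<in> loc_frac S a s \<Longrightarrow> t \<in> S \<and> (\<exists>w\<in>S. w * (a * t - b * s) = 0)"
  by (auto simp: loc_frac_def loc_rel_def)

lemma mult_loc_frac:
  assumes "s \<in> S" "t \<in> S"
  shows "loc_frac S a s \<otimes>\<^bsub>localization S\<^esub> loc_frac S b t = loc_frac S (a * b) (s * t)"
proof -
  have "loc_frac S (a' * b') (s' * t') = loc_frac S (a * b) (s * t)"
    if "(a', s') \<in> loc_frac S a s" "(b', t') \<in> loc_frac S b t" for a' s' b' t'
  proof -
    from loc_frac_mem[OF that(1)] loc_frac_mem[OF that(2)] obtain w w' where *:
      "s' \<in> S" "t' \<in> S" "w \<in> S" "w' \<in> S"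
      "w * (a * s' - a' * s) = 0" "w' * (b * t' - b' * t) = 0" by blast
    have "(w * w') * ((a' * b') * (s * t) - (a * b) * (s' * t'))
       = - (w' * b * t') * (w * (a * s' - a' * s)) - (w * a' * s) * (w' * (b * t' - b' * t))"
      by (simp add: algebra_simps)
    also have "\<dots> = 0" using * by simp
    finally show ?thesis using * assms by (meson loc_frac_eq_iff mult_mem)
  qed
  then show ?thesis
    unfolding localization_def monoid.simps ring.simps partial_object.simps
    by (intro UN2_const[OF loc_frac_self[OF assms(1)] loc_frac_self[OF assms(2)]])
qed

lemma add_loc_frac:
  assumes "s \<in> S" "t \<in> S"
  shows "loc_frac S a s \<oplus>\<^bsub>localization S\<^esub> loc_frac S b t = loc_frac S (a * t + b * s) (s * t)"
proof -
  have "loc_frac S (a' * t' + b' * s') (s' * t') = loc_frac S (a * t + b * s) (s * t)"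
    if "(a', s') \<in> loc_frac S a s" "(b', t') \<in> loc_frac S b t" for a' s' b' t'
  proof -
    from loc_frac_mem[OF that(1)] loc_frac_mem[OF that(2)] obtain w w' where *:
      "s' \<in> S" "t' \<in> S" "w \<in> S" "w' \<in> S"
      "w * (a * s' - a' * s) = 0" "w' * (b * t' - b' * t) = 0" by blast
    have "(w * w') * ((a' * t' + b' * s') * (s * t) - (a * t + b * s) * (s' * t'))
       = - (w' * t * t') * (w * (a * s' - a' * s)) - (w * s * s') * (w' * (b * t' - b' * t))"
      by (simp add: algebra_simps)
    also have "\<dots> = 0" using * by simp
    finally show ?thesis using * assms by (meson loc_frac_eq_iff mult_mem)
  qed
  then show ?thesis
    unfolding localization_def monoid.simps ring.simps partial_object.simps
    by (intro UN2_const[OF loc_frac_self[OF assms(1)] loc_frac_self[OF assms(2)]])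
qed

lemma zero_localization: "\<zero>\<^bsub>localization S\<^esub> = loc_frac S 0 1"
  and one_localization: "\<one>\<^bsub>localization S\<^esub> = loc_frac S 1 1"
  by (simp_all add: localization_def)

lemma loc_frac_eqI: "s \<in> S \<Longrightarrow> t \<in> S \<Longrightarrow> a * t = b * s \<Longrightarrow> loc_frac S a s = loc_frac S b t"
  using loc_frac_eq_iff one_mem by fastforce

lemma loc_cases:
  assumes "x \<in> carrier (localization S)"
  obtains a s where "x = loc_frac S a s" "s \<in> S"
  using assms by (auto simp: carrier_localization)

lemma loc_frac_in_carrier: "s \<in> S \<Longrightarrow> loc_frac S a s \<in> carrier (localization S)"
  by (auto simp: carrier_localization)

lemma cring_localization: "cring (localization S)"
proof (rule cringI)
  note simps = add_loc_frac mult_loc_frac zero_localization one_localization mult_mem one_mem loc_frac_in_carrier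
  show "abelian_group (localization S)"
  proof (rule abelian_groupI)
    fix x y assume "x \<in> carrier (localization S)" "y \<in> carrier (localization S)"
    then show "x \<oplus>\<^bsub>localization S\<^esub> y \<in> carrier (localization S)"
      by (elim loc_cases) (simp add: simps)
  next
    show "\<zero>\<^bsub>localization S\<^esub> \<in> carrier (localization S)" by (simp add: simps)
  next
    fix x y z assume "x \<in> carrier (localization S)" "y \<in> carrier (localization S)"
      "z \<in> carrier (localization S)"
    then show "x \<oplus>\<^bsub>localization S\<^esub> y \<oplus>\<^bsub>localization S\<^esub> z
        = x \<oplus>\<^bsub>localization S\<^esub> (y \<oplus>\<^bsub>localization S\<^esub> z)"
      by (elim loc_cases) (simp add: simps algebra_simps)
  next
    fix x y assume "x \<in> carrier (localization S)" "y \<in> carrier (localization S)"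
    then show "x \<oplus>\<^bsub>localization S\<^esub> y = y \<oplus>\<^bsub>localization S\<^esub> x"
      by (elim loc_cases) (simp add: simps algebra_simps)
  next
    fix x assume "x \<in> carrier (localization S)"
    then show "\<zero>\<^bsub>localization S\<^esub> \<oplus>\<^bsub>localization S\<^esub> x = x"
      by (elim loc_cases) (simp add: simps)
  next
    fix x assume "x \<in> carrier (localization S)"
    then obtain a s where x: "x = loc_frac S a s" "s \<in> S" by (rule loc_cases)
    have "loc_frac S (- a * s + a * s) (s * s) = loc_frac S 0 1"
      using x by (intro loc_frac_eqI) (simp_all add: simps)
    then have "loc_frac S (- a) s \<oplus>\<^bsub>localization S\<^esub> x = \<zero>\<^bsub>localization S\<^esub>"
      using x by (simp add: simps)
    with x show "\<exists>y\<in>carrier (localization S). y \<oplus>\<^bsub>localization S\<^esub> x = \<zero>\<^bsub>localization S\<^esub>"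
      using loc_frac_in_carrier by blast
  qed
  show "Group.comm_monoid (localization S)"
  proof (rule comm_monoidI)
    fix x y assume "x \<in> carrier (localization S)" "y \<in> carrier (localization S)"
    then show "x \<otimes>\<^bsub>localization S\<^esub> y \<in> carrier (localization S)"
      by (elim loc_cases) (simp add: simps)
  next
    show "\<one>\<^bsub>localization S\<^esub> \<in> carrier (localization S)" by (simp add: simps)
  next
    fix x y z assume "x \<in> carrier (localization S)" "y \<in> carrier (localization S)"
      "z \<in> carrier (localization S)"
    then show "x \<otimes>\<^bsub>localization S\<^esub> y \<otimes>\<^bsub>localization S\<^esub> z
        = x \<otimes>\<^bsub>localization S\<^esub> (y \<otimes>\<^bsub>localization S\<^esub> z)"
      by (elim loc_cases) (simp add: simps mult.assoc)
  next
    fix x assume "x \<in> carrier (localization S)"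
    then show "\<one>\<^bsub>localization S\<^esub> \<otimes>\<^bsub>localization S\<^esub> x = x"
      by (elim loc_cases) (simp add: simps)
  next
    fix x y assume "x \<in> carrier (localization S)" "y \<in> carrier (localization S)"
    then show "x \<otimes>\<^bsub>localization S\<^esub> y = y \<otimes>\<^bsub>localization S\<^esub> x"
      by (elim loc_cases) (simp add: simps mult.commute)
  qed
  fix x y z assume "x \<in> carrier (localization S)" "y \<in> carrier (localization S)"
    "z \<in> carrier (localization S)"
  then show "(x \<oplus>\<^bsub>localization S\<^esub> y) \<otimes>\<^bsub>localization S\<^esub> z
      = x \<otimes>\<^bsub>localization S\<^esub> z \<oplus>\<^bsub>localization S\<^esub> y \<otimes>\<^bsub>localization S\<^esub> z"
    by (elim loc_cases) (simp add: simps, intro loc_frac_eqI mult_mem, simp_all add: algebra_simps)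
qed

end

section \<open>Laurent polynomials over a group ring\<close>

text \<open>
  The abelian group is a type of class \<^class>\<open>ab_group_add\<close>, so its operation is
  written additively; the convolution product of \<^type>\<open>poly_mapping\<close> then makes
  \<open>'g \<Rightarrow>\<^sub>0 'r\<close> the group ring, in which \<open>Poly_Mapping.single g 1\<close> is the basis element \<open>g\<close>.
  Likewise the Laurent polynomials are the group ring of the lattice, with
  \<open>Poly_Mapping.single \<alpha> 1\<close> for the monomial with exponent vector \<open>\<alpha>\<close>.
\<close>

type_synonym ('g, 'r) group_ring = "'g \<Rightarrow>\<^sub>0 'r"

type_synonym ('d, 'a) laurent = "(int ^ 'd) \<Rightarrow>\<^sub>0 'a"

definition weighted_monom ::
  "(int ^ 'd \<Rightarrow> 'g) \<Rightarrow> int ^ 'd \<Rightarrow>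
    ('d, ('g::ab_group_add, 'r::comm_ring_1) group_ring) laurent" where
  "weighted_monom \<phi> \<alpha> = Poly_Mapping.single \<alpha> (Poly_Mapping.single (\<phi> \<alpha>) 1)"

text \<open>The multiplicative set generated by the elements \<open>1 - \<phi>(u) z\<^sup>u\<close>. The vector \<open>u = 0\<close> must
  be left out: it would contribute the element \<open>0\<close> and the localization would collapse.\<close>

inductive_set denominators ::
  "(int ^ 'd \<Rightarrow> 'g) \<Rightarrow> ('d, ('g::ab_group_add, 'r::comm_ring_1) group_ring) laurent set"
  for \<phi> :: "int ^ 'd \<Rightarrow> 'g" where
  one: "1 \<in> denominators \<phi>"
| step: "q \<in> denominators \<phi> \<Longrightarrow> u \<noteq> 0 \<Longrightarrow> (1 - weighted_monom \<phi> u) * q \<in> denominators \<phi>"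

lemma mult_submonoid_denominators: "mult_submonoid (denominators \<phi>)"
proof
  show "1 \<in> denominators \<phi>" by (rule denominators.one)
  show "s * t \<in> denominators \<phi>" if "s \<in> denominators \<phi>" "t \<in> denominators \<phi>" for s t
    using that by induction (simp_all add: mult.assoc denominators.step)
qed

section \<open>Integer point transforms\<close>

definition of_int_vec :: "int ^ 'd \<Rightarrow> real ^ 'd" where
  "of_int_vec \<alpha> = (\<chi> i. of_int (\<alpha> $ i))"

definition rational_vec :: "real ^ 'd \<Rightarrow> bool" where
  "rational_vec x \<longleftrightarrow> (\<forall>i. x $ i \<in> \<rat>)"

definition rational_polytope :: "(real ^ 'd) set \<Rightarrow> bool" where
  "rational_polytope P \<longleftrightarrow> (\<exists>V. finite V \<and> (\<forall>v\<in>V. rational_vec v) \<and> P = convex hull V)"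

text \<open>To be used for bounded \<open>Q\<close> only; over infinitely many lattice points
  \<^const>\<open>sum\<close> returns \<open>0\<close>.\<close>

definition laurent_transform ::
  "(int ^ 'd \<Rightarrow> 'g) \<Rightarrow> (real ^ 'd) set \<Rightarrow>
    ('d, ('g::ab_group_add, 'r::comm_ring_1) group_ring) laurent" where
  "laurent_transform \<phi> Q = (\<Sum>\<alpha> | of_int_vec \<alpha> \<in> Q. weighted_monom \<phi> \<alpha>)"

text \<open>Half-open simplicial cones with apex \<open>v\<close>. The facets opposite to the generators in \<open>B\<close>
  are removed, those opposite to the generators in \<open>A\<close> are kept. The number of generators may
  be smaller than the dimension of the ambient space.\<close>

definition simplicial_generators :: "(int ^ 'd) set \<Rightarrow> (int ^ 'd) set \<Rightarrow> bool" where
  "simplicial_generators A B \<longleftrightarrow>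
    finite A \<and> finite B \<and> A \<inter> B = {} \<and> independent (of_int_vec ` (A \<union> B))"

definition half_open_cone ::
  "real ^ 'd \<Rightarrow> (int ^ 'd) set \<Rightarrow> (int ^ 'd) set \<Rightarrow> (real ^ 'd) set" where
  "half_open_cone v A B =
    {v + (\<Sum>u\<in>A \<union> B. c u *\<^sub>R of_int_vec u) | c. (\<forall>u\<in>A. 0 \<le> c u) \<and> (\<forall>u\<in>B. 0 < c u)}"

definition half_open_parallelepiped ::
  "real ^ 'd \<Rightarrow> (int ^ 'd) set \<Rightarrow> (int ^ 'd) set \<Rightarrow> (real ^ 'd) set" where
  "half_open_parallelepiped v A B =
    {v + (\<Sum>u\<in>A \<union> B. c u *\<^sub>R of_int_vec u) | c.
      (\<forall>u\<in>A. 0 \<le> c u \<and> c u < 1) \<and> (\<forall>u\<in>B. 0 < c u \<and> c u \<le> 1)}"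

definition half_open_cone_transform ::
  "(int ^ 'd \<Rightarrow> 'g) \<Rightarrow> real ^ 'd \<Rightarrow> (int ^ 'd) set \<Rightarrow> (int ^ 'd) set \<Rightarrow>
    (('d, ('g::ab_group_add, 'r::comm_ring_1) group_ring) laurent \<times>
     ('d, ('g, 'r) group_ring) laurent) set" where
  "half_open_cone_transform \<phi> v A B =
    loc_frac (denominators \<phi>)
      (laurent_transform \<phi> (half_open_parallelepiped v A B))
      (\<Prod>u\<in>A \<union> B. 1 - weighted_monom \<phi> u)"

definition half_open_decomposition ::
  "(real ^ 'd) set \<Rightarrow> real ^ 'd \<Rightarrow> ((int ^ 'd) set \<times> (int ^ 'd) set) set \<Rightarrow> bool" where
  "half_open_decomposition K v D \<longleftrightarrow>
    finite D \<and> rational_vec v \<and> (\<forall>(A, B)\<in>D. simplicial_generators A B) \<and>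
    disjoint_family_on (\<lambda>(A, B). half_open_cone v A B) D \<and>
    (\<Union>(A, B)\<in>D. half_open_cone v A B) = K"

text \<open>The rational function of a pointed rational cone \<open>K\<close>. The definite description encodes
  that the value does not depend on the decomposition chosen.\<close>

definition cone_transform ::
  "(int ^ 'd \<Rightarrow> 'g) \<Rightarrow> (real ^ 'd) set \<Rightarrow>
    (('d, ('g::ab_group_add, 'r::comm_ring_1) group_ring) laurent \<times>
     ('d, ('g, 'r) group_ring) laurent) set" where
  "cone_transform \<phi> K =
    (THE r. \<exists>v D. half_open_decomposition K v D \<and>
      r = (\<Oplus>\<^bsub>localization (denominators \<phi>)\<^esub>p\<in>D.
        half_open_cone_transform \<phi> v (fst p) (snd p)))"

definition vertex_cone :: "real ^ 'd \<Rightarrow> (real ^ 'd) set \<Rightarrow> (real ^ 'd) set" where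
  "vertex_cone v P = {v + t *\<^sub>R (u - v) | t u. u \<in> P \<and> 0 \<le> t}"

end

(*
  A two-sided formal Laurent series f represents the fraction p/q when q f = p for a
  denominator q and a Laurent polynomial p; this fraction is unique, additive in f, and 0 for
  the indicator series of a lattice set invariant under a nonzero integer translation. The series
  of a half-open simplicial cone represents the quotient in its transform, so the transform of a
  cone is the fraction of its indicator series and the choice of decomposition is irrelevant.

  Order the vertices of P and write each point in its lexicographically minimal barycentric
  coordinates. The supports that occur triangulate P into relatively open simplices; letting the
  coordinate of v take any sign, the same supports that contain v give the decomposition of the
  vertex cone at v. This reduces the theorem to one open simplex with vertex set T, and there it
  follows from expanding prod_{w in T} ([c_w > 0] - 1) = 0, valid as the barycentric coordinates c
  of a point sum to 1: a term with at least two factors -1 is invariant along a line.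
*)
theory Submission imports Defs begin

section \<open>Fractions represented by two-sided series\<close>

text \<open>Convolution. Two-sided series cannot be multiplied with each other in general, but they
  form a module over the finitely supported ones, and this is its scalar action.\<close>

definition series_act :: "('a::ab_group_add \<Rightarrow>\<^sub>0 'b::comm_ring_1) \<Rightarrow> ('a \<Rightarrow> 'b) \<Rightarrow> 'a \<Rightarrow> 'b" where
  "series_act p f \<alpha> = (\<Sum>\<beta>\<in>Poly_Mapping.keys p. Poly_Mapping.lookup p \<beta> * f (\<alpha> - \<beta>))"

lemma series_act_superset:
  assumes "finite S" "Poly_Mapping.keys p \<subseteq> S"
  shows "series_act p f \<alpha> = (\<Sum>\<beta>\<in>S. Poly_Mapping.lookup p \<beta> * f (\<alpha> - \<beta>))"
  unfolding series_act_def using assms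
  by (intro sum.mono_neutral_left) (auto simp: in_keys_iff)

lemma series_act_single: "series_act (Poly_Mapping.single \<beta> c) f \<alpha> = c * f (\<alpha> - \<beta>)"
  by (subst series_act_superset[of "{\<beta>}"]) auto

lemma series_act_one: "series_act 1 f = f"
  by (metis series_act_single single_one mult_1 diff_zero ext)

lemma series_act_add: "series_act (p + q) f \<alpha> = series_act p f \<alpha> + series_act q f \<alpha>"
proof -
  let ?S = "Poly_Mapping.keys p \<union> Poly_Mapping.keys q"
  have "Poly_Mapping.keys (p + q) \<subseteq> ?S" by (rule Poly_Mapping.keys_add)
  then show ?thesis
    by (simp add: series_act_superset[of ?S] lookup_add sum.distrib distrib_right)
qed

lemma series_act_diff: "series_act (p - q) f \<alpha> = series_act p f \<alpha> - series_act q f \<alpha>"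
  using series_act_add[of "p - q" q f \<alpha>] by simp

lemma series_act_add_right:
  "series_act p (\<lambda>\<alpha>. f \<alpha> + g \<alpha>) \<alpha> = series_act p f \<alpha> + series_act p g \<alpha>"
  by (simp add: series_act_def distrib_left sum.distrib)

lemma series_act_diff_right:
  "series_act p (\<lambda>\<alpha>. f \<alpha> - g \<alpha>) \<alpha> = series_act p f \<alpha> - series_act p g \<alpha>"
  by (simp add: series_act_def right_diff_distrib sum_subtractf)

lemma series_act_scale: "series_act p (\<lambda>\<alpha>. c * f \<alpha>) \<alpha> = c * series_act p f \<alpha>"
  by (simp add: series_act_def sum_distrib_left mult.left_commute)

lemma series_act_zero_right: "series_act p (\<lambda>_. 0) = (\<lambda>_. 0)"
  by (simp add: series_act_def fun_eq_iff)

lemma poly_mapping_eq_sum_single: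
  "p = (\<Sum>k\<in>Poly_Mapping.keys p. Poly_Mapping.single k (Poly_Mapping.lookup p k))"
  by (rule poly_mapping_eqI)
    (auto simp: lookup_sum lookup_single when_def sum.delta' in_keys_iff)

text \<open>Identities additive in \<open>p\<close> need checking on monomials only.\<close>

lemma poly_mapping_single_induct [case_names single add]:
  fixes p :: "'a \<Rightarrow>\<^sub>0 'b::comm_monoid_add"
  assumes single: "\<And>k c. P (Poly_Mapping.single k c)"
    and add: "\<And>p q. P p \<Longrightarrow> P q \<Longrightarrow> P (p + q)"
  shows "P p"
proof -
  have "P (\<Sum>k\<in>S. Poly_Mapping.single k (Poly_Mapping.lookup p k))" if "finite S" for S
    \<comment> \<open>The empty sum is \<open>0\<close>, which is a monomial with coefficient
      \<open>0\<close>; its exponent is arbitrary.\<close>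
    using that single[of undefined 0] by induction (auto intro: assms)
  from this[of "Poly_Mapping.keys p"] show ?thesis
    by (simp flip: poly_mapping_eq_sum_single)
qed

text \<open>The module law. Both sides are additive in \<open>p\<close> and in \<open>q\<close>, so
  two monomials suffice, where exponents add and coefficients multiply.\<close>

lemma series_act_mult: "series_act (p * q) f = series_act p (series_act q f)"
proof (induction p rule: poly_mapping_single_induct)
  case (single k c)
  show ?case
  proof (induction q rule: poly_mapping_single_induct)
    case (single l d)
    show ?case
      by (simp add: mult_single fun_eq_iff series_act_single algebra_simps)
  next
    case (add q r)
    have "series_act (q + r) f = (\<lambda>\<alpha>. series_act q f \<alpha> + series_act r f \<alpha>)"
      by (rule ext) (rule series_act_add)
    with add show ?case
      by (simp add: fun_eq_iff distrib_left series_act_add series_act_add_right)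
  qed
next
  case (add p r)
  then show ?case by (simp add: fun_eq_iff distrib_right series_act_add)
qed

text \<open>Laurent polynomials sit inside the series as the orbit of the delta series at
  \<open>0\<close>; through the module law this identifies the action on them with
  multiplication.\<close>

lemma series_act_unit: "series_act p (\<lambda>\<alpha>. 1 when \<alpha> = 0) = Poly_Mapping.lookup p"
proof
  fix \<alpha>
  show "series_act p (\<lambda>\<alpha>. 1 when \<alpha> = 0) \<alpha> = Poly_Mapping.lookup p \<alpha>"
    by (auto simp: series_act_def when_def in_keys_iff if_distrib[of "(*) _"] eq_commute[of \<alpha>]
        sum.delta cong: if_cong)
qed

lemma series_act_lookup:
  "series_act p (Poly_Mapping.lookup q) = Poly_Mapping.lookup (p * q)"
  by (metis series_act_mult series_act_unit)

section \<open>Fractions of series and torsion\<close>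

locale laurent_localization = mult_submonoid S
  for S :: "('a::ab_group_add \<Rightarrow>\<^sub>0 'b::comm_ring_1) set"
begin

text \<open>A relation and not a function, since an arbitrary series need not be turned into a
  Laurent polynomial by any element of \<open>S\<close>.\<close>

definition has_fraction ::
  "('a \<Rightarrow> 'b) \<Rightarrow> (('a \<Rightarrow>\<^sub>0 'b) \<times> ('a \<Rightarrow>\<^sub>0 'b)) set \<Rightarrow> bool" where
  "has_fraction f r \<longleftrightarrow>
    (\<exists>p q. q \<in> S \<and> series_act q f = Poly_Mapping.lookup p \<and> r = loc_frac S p q)"

text \<open>The series that vanish after localization; their fraction is zero.\<close>

definition torsion_series :: "('a \<Rightarrow> 'b) \<Rightarrow> bool" where
  "torsion_series f \<longleftrightarrow> (\<exists>q\<in>S. series_act q f = (\<lambda>_. 0))"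

lemma has_fractionI:
  "q \<in> S \<Longrightarrow> series_act q f = Poly_Mapping.lookup p \<Longrightarrow> has_fraction f (loc_frac S p q)"
  unfolding has_fraction_def by blast

lemma has_fraction_lookup: "has_fraction (Poly_Mapping.lookup p) (loc_frac S p 1)"
  by (rule has_fractionI) (simp_all add: one_mem series_act_one)

lemma has_fraction_carrier: "has_fraction f r \<Longrightarrow> r \<in> carrier (localization S)"
  by (auto simp: has_fraction_def loc_frac_in_carrier)

lemma torsion_series_add:
  assumes "torsion_series f" "torsion_series g"
  shows "torsion_series (\<lambda>\<alpha>. f \<alpha> + g \<alpha>)"
proof -
  from assms obtain q q' where *: "q \<in> S" "q' \<in> S"
    "series_act q f = (\<lambda>_. 0)" "series_act q' g = (\<lambda>_. 0)"
    unfolding torsion_series_def by blast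
  have "series_act (q' * q) f = (\<lambda>_. 0)"
    using * by (simp add: series_act_mult series_act_zero_right)
  moreover have "series_act (q' * q) g = (\<lambda>_. 0)"
    using * by (simp add: series_act_mult series_act_zero_right mult.commute[of q'])
  ultimately have "series_act (q' * q) (\<lambda>\<alpha>. f \<alpha> + g \<alpha>) = (\<lambda>_. 0)"
    by (simp add: fun_eq_iff series_act_add_right)
  then show ?thesis unfolding torsion_series_def using * mult_mem by blast
qed

lemma torsion_series_scale: "torsion_series f \<Longrightarrow> torsion_series (\<lambda>\<alpha>. c * f \<alpha>)"
  unfolding torsion_series_def
  by (elim bexE, rule bexI) (simp_all add: fun_eq_iff series_act_scale)

lemma torsion_series_zero: "torsion_series (\<lambda>_. 0)"
  unfolding torsion_series_def using one_mem series_act_zero_right by blast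

lemma torsion_series_sum:
  "(\<And>i. i \<in> I \<Longrightarrow> torsion_series (f i)) \<Longrightarrow> torsion_series (\<lambda>\<alpha>. \<Sum>i\<in>I. f i \<alpha>)"
  by (induction I rule: infinite_finite_induct)
    (simp_all add: torsion_series_zero torsion_series_add)

text \<open>A denominator \<open>t\<close> that kills the difference acts equally on
  \<open>f\<close> and \<open>g\<close>. Extending the fraction of \<open>f\<close> by
  \<open>t\<close> keeps its value and makes it a fraction of \<open>g\<close>.\<close>

lemma has_fraction_cong_torsion:
  assumes "has_fraction f r" "torsion_series (\<lambda>\<alpha>. f \<alpha> - g \<alpha>)"
  shows "has_fraction g r"
proof -
  from assms obtain p q t where *: "q \<in> S" "series_act q f = Poly_Mapping.lookup p"
    "r = loc_frac S p q" "t \<in> S" "series_act t (\<lambda>\<alpha>. f \<alpha> - g \<alpha>) = (\<lambda>_. 0)"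
    unfolding torsion_series_def has_fraction_def by blast
  have "series_act t g = series_act t f"
    using *(5) by (simp add: fun_eq_iff series_act_diff_right)
  then have "series_act (t * q) g = Poly_Mapping.lookup (t * p)"
    using * by (metis series_act_mult series_act_lookup mult.commute)
  then have "has_fraction g (loc_frac S (t * p) (t * q))"
    using * by (intro has_fractionI mult_mem)
  moreover have "loc_frac S (t * p) (t * q) = r"
    unfolding *(3) using * by (intro loc_frac_eqI mult_mem) (simp_all add: algebra_simps)
  ultimately show ?thesis by simp
qed

text \<open>Applying \<open>q * q'\<close> to \<open>f\<close> in either order gives
  \<open>q' * p\<close> and \<open>q * p'\<close>, so the two fractions agree by
  cross-multiplication.\<close>

lemma has_fraction_unique:
  assumes "has_fraction f r" "has_fraction f r'"
  shows "r = r'"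
proof -
  from assms obtain p q p' q' where *: "q \<in> S" "series_act q f = Poly_Mapping.lookup p"
    "r = loc_frac S p q" "q' \<in> S" "series_act q' f = Poly_Mapping.lookup p'" "r' = loc_frac S p' q'"
    unfolding has_fraction_def by blast
  have "Poly_Mapping.lookup (q' * p) = Poly_Mapping.lookup (q * p')"
    using * by (metis series_act_mult series_act_lookup mult.commute)
  then have "q' * p = q * p'" by (simp add: lookup_inject)
  then show ?thesis
    unfolding *(3,6) using * by (intro loc_frac_eqI) (simp_all add: mult.commute)
qed

lemma has_fraction_add:
  assumes "has_fraction f r" "has_fraction g r'"
  shows "has_fraction (\<lambda>\<alpha>. f \<alpha> + g \<alpha>) (r \<oplus>\<^bsub>localization S\<^esub> r')"
proof -
  from assms obtain p q p' q' where *: "q \<in> S" "series_act q f = Poly_Mapping.lookup p"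
    "r = loc_frac S p q" "q' \<in> S" "series_act q' g = Poly_Mapping.lookup p'" "r' = loc_frac S p' q'"
    unfolding has_fraction_def by blast
  have "series_act (q * q') f = Poly_Mapping.lookup (p * q')"
    using * by (metis series_act_mult series_act_lookup mult.commute)
  moreover have "series_act (q * q') g = Poly_Mapping.lookup (p' * q)"
    using * by (metis series_act_mult series_act_lookup mult.commute)
  ultimately have "series_act (q * q') (\<lambda>\<alpha>. f \<alpha> + g \<alpha>) = Poly_Mapping.lookup (p * q' + p' * q)"
    by (simp add: fun_eq_iff series_act_add_right lookup_add)
  then have "has_fraction (\<lambda>\<alpha>. f \<alpha> + g \<alpha>) (loc_frac S (p * q' + p' * q) (q * q'))"
    using * by (intro has_fractionI mult_mem)
  then show ?thesis using * by (simp add: add_loc_frac)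
qed

lemma has_fraction_finsum:
  assumes "finite I" "\<And>i. i \<in> I \<Longrightarrow> has_fraction (f i) (r i)"
  shows "has_fraction (\<lambda>\<alpha>. \<Sum>i\<in>I. f i \<alpha>) (\<Oplus>\<^bsub>localization S\<^esub>i\<in>I. r i)"
  using assms
proof (induction I)
  case empty
  interpret cring "localization S" by (rule cring_localization)
  show ?case
    using has_fraction_lookup[of 0] by (simp add: zero_localization lookup_zero[abs_def])
next
  case (insert i I)
  interpret cring "localization S" by (rule cring_localization)
  have "r \<in> I \<rightarrow> carrier (localization S)" "r i \<in> carrier (localization S)"
    using insert by (auto intro: has_fraction_carrier)
  with insert show ?case by (simp add: has_fraction_add)
qed

end

section \<open>Transforms of half-open cones\<close>

lemma inj_of_int_vec: "inj of_int_vec"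
  by (auto simp: inj_def of_int_vec_def vec_eq_iff)

lemma of_int_vec_0 [simp]: "of_int_vec 0 = 0"
  and of_int_vec_add [simp]: "of_int_vec (a + b) = of_int_vec a + of_int_vec b"
  and of_int_vec_diff [simp]: "of_int_vec (a - b) = of_int_vec a - of_int_vec b"
  by (simp_all add: of_int_vec_def vec_eq_iff)

lemma finite_bounded_int_vec: "finite {\<alpha> :: int ^ 'd. \<forall>i. \<alpha> $ i \<in> {a..b}}"
proof -
  have "finite {f :: 'd \<Rightarrow> int. \<forall>i. f i \<in> {a..b}}"
    using finite_PiE[of "UNIV :: 'd set" "\<lambda>_. {a..b}"] by (simp add: PiE_UNIV_domain Pi_def)
  moreover have "{\<alpha> :: int ^ 'd. \<forall>i. \<alpha> $ i \<in> {a..b}} \<subseteq> vec_lambda ` {f. \<forall>i. f i \<in> {a..b}}"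
  proof
    fix \<alpha> :: "int ^ 'd" assume "\<alpha> \<in> {\<alpha>. \<forall>i. \<alpha> $ i \<in> {a..b}}"
    then show "\<alpha> \<in> vec_lambda ` {f. \<forall>i. f i \<in> {a..b}}"
      by (intro image_eqI[of _ _ "vec_nth \<alpha>"]) simp_all
  qed
  ultimately show ?thesis by (meson finite_imageI finite_subset)
qed

lemma finite_lattice_points:
  assumes "bounded Q"
  shows "finite {\<alpha>. of_int_vec \<alpha> \<in> Q}"
proof -
  from assms obtain N where N: "\<And>x. x \<in> Q \<Longrightarrow> norm x \<le> N"
    unfolding bounded_iff by blast
  have "\<alpha> $ i \<in> {-\<lceil>N\<rceil>..\<lceil>N\<rceil>}" if "of_int_vec \<alpha> \<in> Q" for \<alpha> i
  proof -
    have "\<bar>of_int (\<alpha> $ i)\<bar> \<le> N"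
      using component_le_norm_cart[of "of_int_vec \<alpha>" i] N[OF that] by (simp add: of_int_vec_def)
    then show ?thesis by (simp add: abs_le_iff) linarith
  qed
  then show ?thesis
    by (intro finite_subset[OF _ finite_bounded_int_vec]) auto
qed

text \<open>The formal integer point transform as a coefficient function. In contrast to
  \<open>laurent_transform\<close> it is meaningful for unbounded \<open>Q\<close> as well.\<close>

definition lattice_series ::
  "(int ^ 'd \<Rightarrow> 'g) \<Rightarrow> (real ^ 'd) set \<Rightarrow> int ^ 'd \<Rightarrow>
    ('g::ab_group_add, 'r::comm_ring_1) group_ring" where
  "lattice_series \<phi> Q \<alpha> = (if of_int_vec \<alpha> \<in> Q then Poly_Mapping.single (\<phi> \<alpha>) 1 else 0)"

lemma lookup_laurent_transform:
  assumes "bounded Q"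
  shows "Poly_Mapping.lookup (laurent_transform \<phi> Q) = lattice_series \<phi> Q"
  using finite_lattice_points[OF assms]
  by (simp add: fun_eq_iff laurent_transform_def lookup_sum weighted_monom_def lookup_single
      when_def lattice_series_def)

lemma lattice_series_disjoint_union:
  assumes "finite I" "disjoint_family_on F I"
  shows "(lattice_series \<phi> (\<Union>i\<in>I. F i) \<alpha> :: ('g::ab_group_add, 'r::comm_ring_1) group_ring) =
    (\<Sum>i\<in>I. lattice_series \<phi> (F i) \<alpha>)"
proof (cases "\<exists>i\<in>I. of_int_vec \<alpha> \<in> F i")
  case True
  then obtain i where i: "i \<in> I" "of_int_vec \<alpha> \<in> F i" by blast
  then have "of_int_vec \<alpha> \<in> F j \<longleftrightarrow> j = i" if "j \<in> I" for j
    using that assms(2) by (auto simp: disjoint_family_on_def)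
  then have "(\<Sum>j\<in>I. lattice_series \<phi> (F j) \<alpha> :: ('g, 'r) group_ring) =
      (\<Sum>j\<in>I. if j = i then Poly_Mapping.single (\<phi> \<alpha>) 1 else 0)"
    by (intro sum.cong) (auto simp: lattice_series_def)
  with i assms(1) show ?thesis by (auto simp: lattice_series_def)
qed (auto simp: lattice_series_def intro!: sum.neutral)

section \<open>Denominators and independent integer generators\<close>

lemma one_minus_weighted_monom_in_denominators:
  "u \<noteq> 0 \<Longrightarrow> 1 - weighted_monom \<phi> u \<in> denominators \<phi>"
  using denominators.step[OF denominators.one] by simp

lemma prod_one_minus_weighted_monom_in_denominators:
  "(\<And>u. u \<in> E \<Longrightarrow> u \<noteq> 0) \<Longrightarrow> (\<Prod>u\<in>E. 1 - weighted_monom \<phi> u) \<in> denominators \<phi>"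
  by (induction E rule: infinite_finite_induct) (auto intro: denominators.intros)

lemma laurent_localization_denominators: "laurent_localization (denominators \<phi>)"
  unfolding laurent_localization_def by (rule mult_submonoid_denominators)

text \<open>Independence concerns coefficients indexed by real vectors, so \<open>c - d\<close> is
  transported along the injection \<open>of_int_vec\<close> before it is seen to vanish.\<close>

lemma independent_of_int_vec_unique:
  assumes "finite F" "independent (of_int_vec ` F)"
    and "(\<Sum>u\<in>F. c u *\<^sub>R of_int_vec u) = (\<Sum>u\<in>F. d u *\<^sub>R of_int_vec u)" "u \<in> F"
  shows "c u = d u"
proof -
  have inj: "inj_on of_int_vec F" using inj_of_int_vec by (rule inj_on_subset) simp
  define e where "e x = c (inv_into F of_int_vec x) - d (inv_into F of_int_vec x)" for x
  have "(\<Sum>x\<in>of_int_vec ` F. e x *\<^sub>R x) = (\<Sum>u\<in>F. (c u - d u) *\<^sub>R of_int_vec u)"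
    using inj by (simp add: sum.reindex e_def)
  also have "\<dots> = 0" using assms(3) by (simp add: scaleR_diff_left sum_subtractf)
  finally have "e (of_int_vec u) = 0"
    using independentD[OF assms(2)] assms(1,4) by blast
  then show ?thesis using inj assms(4) by (simp add: e_def)
qed

text \<open>Ensures that the product over the generators is an admissible denominator, as these are
  built from nonzero exponents.\<close>

lemma simplicial_generators_nonzero:
  assumes "simplicial_generators A B" "u \<in> A \<union> B"
  shows "u \<noteq> 0"
proof
  assume "u = 0"
  then have "0 \<in> of_int_vec ` (A \<union> B)" using assms(2) by force
  from dependent_zero[OF this] show False
    using assms(1) by (simp add: simplicial_generators_def)
qed

lemma bounded_half_open_parallelepiped:
  assumes "finite A" "finite B"
  shows "bounded (half_open_parallelepiped v A B)"
proof (rule boundedI)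
  fix x assume "x \<in> half_open_parallelepiped v A B"
  then obtain c where c: "x = v + (\<Sum>u\<in>A \<union> B. c u *\<^sub>R of_int_vec u)"
    "\<forall>u\<in>A. 0 \<le> c u \<and> c u < 1" "\<forall>u\<in>B. 0 < c u \<and> c u \<le> 1"
    unfolding half_open_parallelepiped_def by blast
  have "norm x \<le> norm v + norm (\<Sum>u\<in>A \<union> B. c u *\<^sub>R of_int_vec u)"
    unfolding c(1) by (rule norm_triangle_ineq)
  also have "norm (\<Sum>u\<in>A \<union> B. c u *\<^sub>R of_int_vec u) \<le> (\<Sum>u\<in>A \<union> B. norm (of_int_vec u))"
  proof (rule sum_norm_le)
    fix u assume "u \<in> A \<union> B"
    then have "\<bar>c u\<bar> \<le> 1" using c(2,3) by (auto simp: abs_le_iff dest!: bspec[of _ _ u])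
    then show "norm (c u *\<^sub>R of_int_vec u) \<le> norm (of_int_vec u)"
      by (simp add: mult_left_le_one_le)
  qed
  finally show "norm x \<le> norm v + (\<Sum>u\<in>A \<union> B. norm (of_int_vec u))" by simp
qed

section \<open>The action of denominators on lattice series\<close>

context
  fixes \<phi> :: "int ^ 'd \<Rightarrow> 'g::ab_group_add"
  assumes hom: "\<And>a b. \<phi> (a + b) = \<phi> a + \<phi> b"
begin

text \<open>The homomorphism property splits the weight of \<alpha> into those of \<open>u\<close>
  and \<open>\<alpha> - u\<close>; multiplying by the weighted monomial of \<open>u\<close>
  therefore translates the set by \<open>u\<close>.\<close>

lemma lattice_series_translate:
  "Poly_Mapping.single (\<phi> u) 1 * lattice_series \<phi> Q (\<alpha> - u) =
    (lattice_series \<phi> ((+) (of_int_vec u) ` Q) \<alpha> :: ('g, 'r::comm_ring_1) group_ring)"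
proof -
  have "\<phi> u + \<phi> (\<alpha> - u) = \<phi> \<alpha>" by (simp flip: hom)
  moreover have "of_int_vec \<alpha> \<in> (+) (of_int_vec u) ` Q \<longleftrightarrow> of_int_vec \<alpha> - of_int_vec u \<in> Q"
  proof
    assume "of_int_vec \<alpha> - of_int_vec u \<in> Q"
    then show "of_int_vec \<alpha> \<in> (+) (of_int_vec u) ` Q" by (rule rev_image_eqI) simp
  qed auto
  ultimately show ?thesis by (simp add: lattice_series_def mult_single)
qed

text \<open>The product is the series of \<open>Q\<close> minus that of its translate; inclusion of
  the translate turns the difference into the series of a set difference.\<close>

lemma act_one_minus_weighted_monom:
  assumes "(+) (of_int_vec u) ` Q \<subseteq> Q"
  shows "series_act (1 - weighted_monom \<phi> u) (lattice_series \<phi> Q) =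
    (lattice_series \<phi> (Q - (+) (of_int_vec u) ` Q) :: int ^ 'd \<Rightarrow> ('g, 'r::comm_ring_1) group_ring)"
proof
  fix \<alpha>
  show "series_act (1 - weighted_monom \<phi> u) (lattice_series \<phi> Q) \<alpha> =
    (lattice_series \<phi> (Q - (+) (of_int_vec u) ` Q) \<alpha> :: ('g, 'r) group_ring)"
    unfolding series_act_diff series_act_one weighted_monom_def series_act_single
      lattice_series_translate
    using assms by (auto simp: lattice_series_def)
qed

lemma torsion_lattice_series:
  assumes "u \<noteq> 0" "(+) (of_int_vec u) ` Q = Q"
  shows "laurent_localization.torsion_series (denominators \<phi>)
    (lattice_series \<phi> Q :: int ^ 'd \<Rightarrow> ('g, 'r::comm_ring_1) group_ring)"
proof -
  interpret laurent_localization
    "denominators \<phi> :: ('d, ('g, 'r::comm_ring_1) group_ring) laurent set"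
    by (rule laurent_localization_denominators)
  have "series_act (1 - weighted_monom \<phi> u)
      (lattice_series \<phi> Q :: int ^ 'd \<Rightarrow> ('g, 'r) group_ring) = (\<lambda>_. 0)"
    using assms(2) by (subst act_one_minus_weighted_monom) (simp_all add: lattice_series_def fun_eq_iff)
  then show ?thesis
    unfolding torsion_series_def
    using one_minus_weighted_monom_in_denominators[OF assms(1)] by blast
qed

text \<open>The geometric series in multiplied-out form: each factor removes the part of the cone
  that is its translate by one generator, and what survives all factors is the
  parallelepiped.\<close>

lemma act_half_open_cone:
  fixes A B :: "(int ^ 'd) set"
  assumes gen: "simplicial_generators A B"
  shows "series_act (\<Prod>u\<in>A \<union> B. 1 - weighted_monom \<phi> u) (lattice_series \<phi> (half_open_cone v A B)) =
    (lattice_series \<phi> (half_open_parallelepiped v A B) :: int ^ 'd \<Rightarrow> ('g, 'r::comm_ring_1) group_ring)"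
proof -
  define L where "L c = v + (\<Sum>u\<in>A \<union> B. c u *\<^sub>R of_int_vec u)" for c :: "int ^ 'd \<Rightarrow> real"
  \<comment> \<open>\<open>W E\<close> interpolates between the cone and the parallelepiped: the factor for \<open>u\<close> cuts off the
    translate by \<open>u\<close>.\<close>
  define W where "W E = {L c | c. (\<forall>u\<in>A. 0 \<le> c u \<and> (u \<in> E \<longrightarrow> c u < 1)) \<and>
    (\<forall>u\<in>B. 0 < c u \<and> (u \<in> E \<longrightarrow> c u \<le> 1))}" for E
  from gen have fin: "finite (A \<union> B)" and disj: "A \<inter> B = {}"
    and indep: "independent (of_int_vec ` (A \<union> B))"
    by (auto simp: simplicial_generators_def)
  have L_unique: "c u = d u" if "L c = L d" "u \<in> A \<union> B" for c d u
    using independent_of_int_vec_unique[OF fin indep _ that(2), of c d] that(1) by (simp add: L_def)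
  have L_upd: "L (c(u := c u + t)) = L c + t *\<^sub>R of_int_vec u" if "u \<in> A \<union> B" for c u t
  proof -
    have "(\<Sum>w\<in>A \<union> B. (c(u := c u + t)) w *\<^sub>R of_int_vec w)
        = (\<Sum>w\<in>A \<union> B. c w *\<^sub>R of_int_vec w + (if w = u then t *\<^sub>R of_int_vec u else 0))"
      by (intro sum.cong) (auto simp: scaleR_add_left)
    also have "\<dots> = (\<Sum>w\<in>A \<union> B. c w *\<^sub>R of_int_vec w) + t *\<^sub>R of_int_vec u"
      using fin that by (simp only: sum.distrib sum.delta) simp
    finally show ?thesis by (simp add: L_def)
  qed
  have sub: "(+) (of_int_vec u) ` W E \<subseteq> W E" if "u \<in> A \<union> B" "u \<notin> E" for u E
  proof
    fix y assume "y \<in> (+) (of_int_vec u) ` W E"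
    then obtain c where c: "y = of_int_vec u + L c"
      "\<forall>u\<in>A. 0 \<le> c u \<and> (u \<in> E \<longrightarrow> c u < 1)" "\<forall>u\<in>B. 0 < c u \<and> (u \<in> E \<longrightarrow> c u \<le> 1)"
      unfolding W_def by auto
    have "y = L (c(u := c u + 1))" using L_upd[OF that(1), of c 1] c(1) by simp
    moreover have "(\<forall>w\<in>A. 0 \<le> (c(u := c u + 1)) w \<and> (w \<in> E \<longrightarrow> (c(u := c u + 1)) w < 1)) \<and>
      (\<forall>w\<in>B. 0 < (c(u := c u + 1)) w \<and> (w \<in> E \<longrightarrow> (c(u := c u + 1)) w \<le> 1))"
      using c(2,3) that by (auto simp: add_pos_pos)
    ultimately show "y \<in> W E" unfolding W_def by blast
  qed
  \<comment> \<open>Since coefficients are unique, a point lies in the translate exactly when its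
    coefficient at \<open>u\<close> may be lowered by one.\<close>
  have diff: "W E - (+) (of_int_vec u) ` W E = W (insert u E)" if "u \<in> A \<union> B" "u \<notin> E" for u E
  proof (intro equalityI subsetI)
    fix y assume y: "y \<in> W E - (+) (of_int_vec u) ` W E"
    then obtain c where c: "y = L c"
      "\<forall>u\<in>A. 0 \<le> c u \<and> (u \<in> E \<longrightarrow> c u < 1)" "\<forall>u\<in>B. 0 < c u \<and> (u \<in> E \<longrightarrow> c u \<le> 1)"
      unfolding W_def by auto
    define d where "d = c(u := c u + (- 1))"
    have "L c = of_int_vec u + L d"
      unfolding d_def using L_upd[OF that(1), of c "-1"] by simp
    with y c have "L d \<notin> W E" by auto
    \<comment> \<open>A violated bound means \<open>c u >= 1\<close> for \<open>u\<close> in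
      \<open>A\<close> and \<open>c u > 1\<close> for \<open>u\<close> in \<open>B\<close>, so
      lowering by one preserves \<open>0 <= d u\<close> and \<open>0 < d u\<close> respectively.
      This is why the two kinds of generators close opposite ends of the interval.\<close>
    moreover have "L d \<in> W E" if "\<not> ((u \<in> A \<longrightarrow> c u < 1) \<and> (u \<in> B \<longrightarrow> c u \<le> 1))"
    proof -
      have "(\<forall>w\<in>A. 0 \<le> d w \<and> (w \<in> E \<longrightarrow> d w < 1)) \<and> (\<forall>w\<in>B. 0 < d w \<and> (w \<in> E \<longrightarrow> d w \<le> 1))"
        using c(2,3) that \<open>u \<notin> E\<close> disj by (auto simp: d_def)
      then show ?thesis unfolding W_def by blast
    qed
    ultimately have "(u \<in> A \<longrightarrow> c u < 1) \<and> (u \<in> B \<longrightarrow> c u \<le> 1)" by blast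
    with c show "y \<in> W (insert u E)" unfolding W_def by blast
  next
    fix y assume "y \<in> W (insert u E)"
    then obtain c where c: "y = L c"
      "\<forall>w\<in>A. 0 \<le> c w \<and> (w \<in> insert u E \<longrightarrow> c w < 1)"
      "\<forall>w\<in>B. 0 < c w \<and> (w \<in> insert u E \<longrightarrow> c w \<le> 1)"
      unfolding W_def by auto
    have "y \<in> W E" using c unfolding W_def by blast
    moreover have "y \<notin> (+) (of_int_vec u) ` W E"
    proof
      assume "y \<in> (+) (of_int_vec u) ` W E"
      then obtain d where d: "y = of_int_vec u + L d" "\<forall>w\<in>A. 0 \<le> d w" "\<forall>w\<in>B. 0 < d w"
        unfolding W_def by auto
      have "L c = L (d(u := d u + 1))" using L_upd[OF that(1), of d 1] c(1) d(1) by (simp add: add.commute)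
      from L_unique[OF this that(1)] have "c u = d u + 1" by simp
      with c d that show False by force
    qed
    ultimately show "y \<in> W E - (+) (of_int_vec u) ` W E" by blast
  qed
  have act: "series_act (\<Prod>u\<in>E. 1 - weighted_monom \<phi> u) (lattice_series \<phi> (W {})) =
    (lattice_series \<phi> (W E) :: int ^ 'd \<Rightarrow> ('g, 'r) group_ring)"
    if "finite E" "E \<subseteq> A \<union> B" for E
    using that
  proof (induction E)
    case empty
    show ?case by (simp add: series_act_one)
  next
    case (insert u E)
    then show ?case
      by (simp add: series_act_mult act_one_minus_weighted_monom[OF sub] diff)
  qed
  have "half_open_cone v A B = W {}"
    by (simp add: half_open_cone_def W_def L_def)
  moreover have "half_open_parallelepiped v A B = W (A \<union> B)"
    unfolding half_open_parallelepiped_def W_def L_def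
    by simp
  ultimately show ?thesis using act[OF fin] by simp
qed

lemma has_fraction_half_open_cone:
  assumes "simplicial_generators A B"
  shows "laurent_localization.has_fraction (denominators \<phi>)
    (lattice_series \<phi> (half_open_cone v A B) :: int ^ 'd \<Rightarrow> ('g, 'r::comm_ring_1) group_ring)
    (half_open_cone_transform \<phi> v A B)"
proof -
  interpret laurent_localization
    "denominators \<phi> :: ('d, ('g, 'r::comm_ring_1) group_ring) laurent set"
    by (rule laurent_localization_denominators)
  show ?thesis
    unfolding half_open_cone_transform_def using assms
    by (intro has_fractionI prod_one_minus_weighted_monom_in_denominators)
      (simp_all add: simplicial_generators_nonzero act_half_open_cone lookup_laurent_transform
        bounded_half_open_parallelepiped simplicial_generators_def)
qed

text \<open>The series depends on \<open>K\<close> alone, so uniqueness of fractions makes the sum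
  the same for all apices \<open>v\<close> and decompositions \<open>D\<close>.\<close>

lemma has_fraction_half_open_decomposition:
  assumes "half_open_decomposition K v D"
  shows "laurent_localization.has_fraction (denominators \<phi>)
    (lattice_series \<phi> K :: int ^ 'd \<Rightarrow> ('g, 'r::comm_ring_1) group_ring)
    (\<Oplus>\<^bsub>localization (denominators \<phi>)\<^esub>p\<in>D. half_open_cone_transform \<phi> v (fst p) (snd p))"
proof -
  interpret laurent_localization
    "denominators \<phi> :: ('d, ('g, 'r::comm_ring_1) group_ring) laurent set"
    by (rule laurent_localization_denominators)
  let ?F = "\<lambda>p. half_open_cone v (fst p) (snd p)"
  have D: "finite D" "disjoint_family_on ?F D" "(\<Union>p\<in>D. ?F p) = K"
    "\<And>p. p \<in> D \<Longrightarrow> simplicial_generators (fst p) (snd p)"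
    using assms by (auto simp: half_open_decomposition_def case_prod_unfold)
  have "has_fraction (\<lambda>\<alpha>. \<Sum>p\<in>D. lattice_series \<phi> (?F p) \<alpha>)
    (\<Oplus>\<^bsub>localization (denominators \<phi>)\<^esub>p\<in>D. half_open_cone_transform \<phi> v (fst p) (snd p))"
    using D by (intro has_fraction_finsum has_fraction_half_open_cone)
  moreover have "(\<lambda>\<alpha>. \<Sum>p\<in>D. lattice_series \<phi> (?F p) \<alpha>) =
      (lattice_series \<phi> K :: int ^ 'd \<Rightarrow> ('g, 'r) group_ring)"
    unfolding D(3)[symmetric]
    by (rule ext) (rule lattice_series_disjoint_union[OF D(1,2), symmetric])
  ultimately show ?thesis by simp
qed

text \<open>One decomposition justifies the definite description, because every other one yields a
  fraction of the same series.\<close>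

lemma has_fraction_cone_transform:
  assumes "half_open_decomposition K v D"
  shows "laurent_localization.has_fraction (denominators \<phi>)
    (lattice_series \<phi> K :: int ^ 'd \<Rightarrow> ('g, 'r::comm_ring_1) group_ring) (cone_transform \<phi> K)"
proof -
  interpret laurent_localization
    "denominators \<phi> :: ('d, ('g, 'r::comm_ring_1) group_ring) laurent set"
    by (rule laurent_localization_denominators)
  let ?r = "\<lambda>v D. \<Oplus>\<^bsub>localization (denominators \<phi>)\<^esub>p\<in>D.
    half_open_cone_transform \<phi> v (fst p) (snd p) ::
      (('d, ('g, 'r) group_ring) laurent \<times> ('d, ('g, 'r) group_ring) laurent) set"
  have "cone_transform \<phi> K = ?r v D"
    unfolding cone_transform_def
  proof (rule the_equality)
    show "\<exists>v' D'. half_open_decomposition K v' D' \<and> ?r v D = ?r v' D'" using assms by blast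
  next
    fix r assume "\<exists>v' D'. half_open_decomposition K v' D' \<and> r = ?r v' D'"
    then obtain v' D' where D': "half_open_decomposition K v' D'" and r: "r = ?r v' D'" by blast
    show "r = ?r v D"
      unfolding r
      by (rule has_fraction_unique[OF has_fraction_half_open_decomposition[OF D']
            has_fraction_half_open_decomposition[OF assms]])
  qed
  then show ?thesis using has_fraction_half_open_decomposition[OF assms, where 'r = 'r] by simp
qed

end

section \<open>A triangulation from lexicographically minimal coordinates\<close>

text \<open>The first nonzero value along the list is negative. Applied to \<open>a - b\<close> it
  says that \<open>a\<close> is lexicographically smaller than \<open>b\<close>.\<close>

fun lex_neg :: "'a list \<Rightarrow> ('a \<Rightarrow> real) \<Rightarrow> bool" where
  "lex_neg [] d \<longleftrightarrow> False"
| "lex_neg (u # us) d \<longleftrightarrow> d u < 0 \<or> d u = 0 \<and> lex_neg us d"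

lemma lex_neg_add: "lex_neg us c \<Longrightarrow> lex_neg us d \<Longrightarrow> lex_neg us (\<lambda>u. c u + d u)"
  by (induction us) auto

lemma lex_neg_scale: "0 < t \<Longrightarrow> lex_neg us (\<lambda>u. t * c u) \<longleftrightarrow> lex_neg us c"
  by (induction us) (auto simp: mult_less_0_iff)

lemma lex_neg_total: "u \<in> set us \<Longrightarrow> d u \<noteq> 0 \<Longrightarrow> lex_neg us d \<or> lex_neg us (\<lambda>u. - d u)"
  by (induction us) auto

lemma lex_neg_ex_neg: "lex_neg us d \<Longrightarrow> \<exists>u\<in>set us. d u < 0"
  by (induction us) auto

lemma lex_neg_cong: "(\<And>u. u \<in> set us \<Longrightarrow> c u = d u) \<Longrightarrow> lex_neg us c \<longleftrightarrow> lex_neg us d"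
  by (induction us) auto

lemma lex_neg_irrefl: "\<not> lex_neg us (\<lambda>u. c u - c u)"
  using lex_neg_ex_neg by force

lemma lex_neg_trans:
  assumes "lex_neg us (\<lambda>u. a u - b u)" "lex_neg us (\<lambda>u. b u - c u)"
  shows "lex_neg us (\<lambda>u. a u - c u)"
  using lex_neg_add[OF assms] by simp

text \<open>A coordinate with \<open>d u < 0\<close> has \<open>m u > 0\<close> and bounds the step
  by the positive number \<open>m u / - d u\<close>; the minimum of finitely many such bounds is
  positive.\<close>

lemma ex_small_nonneg_step:
  fixes m d :: "'a \<Rightarrow> real"
  assumes "finite U" "\<And>u. u \<in> U \<Longrightarrow> 0 \<le> m u" "\<And>u. u \<in> U \<Longrightarrow> m u = 0 \<Longrightarrow> 0 \<le> d u"
  shows "\<exists>t>0. \<forall>u\<in>U. 0 \<le> m u + t * d u"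
  using assms
proof (induction U)
  case (insert x U)
  then obtain t where t: "t > 0" "\<forall>u\<in>U. 0 \<le> m u + t * d u" by auto
  define t' where "t' = (if 0 \<le> d x then t else min t (m x / - d x))"
  have "0 < m x / - d x" if "\<not> 0 \<le> d x"
  proof (rule divide_pos_pos)
    show "0 < m x" using insert.prems[of x] that by force
  qed (use that in simp)
  then have t': "0 < t'" "t' \<le> t" using t(1) by (auto simp: t'_def)
  have "0 \<le> m u + t' * d u" if "u \<in> U" for u
  proof (cases "0 \<le> d u")
    case True
    then show ?thesis using insert.prems(1)[of u] that t' by simp
  next
    case False
    then have "t * d u \<le> t' * d u" using t' by (simp add: mult_right_mono_neg)
    then show ?thesis using t(2) that by force
  qed
  moreover have "0 \<le> m x + t' * d x"
  proof (cases "0 \<le> d x")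
    case True
    then show ?thesis using insert.prems(1)[of x] t' by simp
  next
    case False
    then have "t' \<le> m x / - d x" by (simp add: t'_def)
    then show ?thesis using False by (simp add: field_simps)
  qed
  ultimately show ?case using t'(1) by blast
qed (auto intro: exI[of _ 1])

section \<open>Affine dependences, lexicographic faces and open pieces\<close>

locale lex_triangulation =
  fixes us :: "'v::real_vector list"
begin

abbreviation V :: "'v set" where "V \<equiv> set us"

text \<open>Affine dependences: the differences of two barycentric coordinate vectors of one
  point.\<close>

definition dependence :: "('v \<Rightarrow> real) \<Rightarrow> bool" where
  "dependence d \<longleftrightarrow> sum d V = 0 \<and> (\<Sum>w\<in>V. d w *\<^sub>R w) = 0"

text \<open>By the second condition, minimality of coordinates depends only on which of them vanish:
  a lexicographic decrease nonnegative off the support remains feasible after scaling down.\<close>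

definition lex_face :: "'v set \<Rightarrow> bool" where
  "lex_face T \<longleftrightarrow> T \<subseteq> V \<and> \<not> (\<exists>d. dependence d \<and> lex_neg us d \<and> (\<forall>w\<in>V - T. 0 \<le> d w))"

text \<open>The coordinates outside \<open>U\<close> (resp. \<open>I\<close>) are unconstrained: all of \<open>V\<close> gives the polytope,
  \<open>V - {v}\<close> the vertex cone at \<open>v\<close>.\<close>

definition sign_hull :: "'v set \<Rightarrow> 'v set" where
  "sign_hull U = {\<Sum>w\<in>V. c w *\<^sub>R w | c. sum c V = 1 \<and> (\<forall>w\<in>U. 0 \<le> c w)}"

definition open_piece :: "'v set \<Rightarrow> 'v set \<Rightarrow> 'v set" where
  "open_piece T I = {\<Sum>w\<in>T. c w *\<^sub>R w | c. sum c T = 1 \<and> (\<forall>w\<in>I. 0 < c w)}"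

lemma dependence_uminus: "dependence d \<Longrightarrow> dependence (\<lambda>w. - d w)"
  by (simp add: dependence_def sum_negf)

lemma finite_lex_faces: "finite {T. lex_face T}"
  by (rule finite_subset[of _ "Pow V"]) (auto simp: lex_face_def)

lemma lex_face_finite: "lex_face T \<Longrightarrow> finite T"
  unfolding lex_face_def by (meson List.finite_set finite_subset)

lemma sum_extend_zero:
  assumes "T \<subseteq> V"
  shows "(\<Sum>w\<in>V. if w \<in> T then c w else (0::real)) = sum c T"
    and "(\<Sum>w\<in>V. (if w \<in> T then c w else 0) *\<^sub>R w) = (\<Sum>w\<in>T. c w *\<^sub>R w)"
  using assms by (auto intro!: sum.mono_neutral_cong_right)

text \<open>A nonzero dependence supported on \<open>T\<close> or its negative is lexicographically
  decreasing, and both vanish off \<open>T\<close>, which a face forbids. The points of a face are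
  thus affinely independent.\<close>

lemma lex_face_independent:
  assumes "lex_face T" "sum d T = 0" "(\<Sum>w\<in>T. d w *\<^sub>R w) = 0" "w \<in> T"
  shows "d w = 0"
proof (rule ccontr)
  assume "d w \<noteq> 0"
  define e where "e w = (if w \<in> T then d w else 0)" for w
  have T: "T \<subseteq> V" using assms(1) by (simp add: lex_face_def)
  have dep: "dependence e"
    unfolding dependence_def e_def using sum_extend_zero[OF T, of d] assms(2,3) by simp
  have "e w \<noteq> 0" "w \<in> V" using \<open>d w \<noteq> 0\<close> assms(4) T by (auto simp: e_def)
  then have "lex_neg us e \<or> lex_neg us (\<lambda>u. - e u)" by (intro lex_neg_total)
  moreover have "\<forall>w\<in>V - T. 0 \<le> e w" "\<forall>w\<in>V - T. 0 \<le> - e w" by (auto simp: e_def)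
  ultimately show False
    using assms(1) dep dependence_uminus[OF dep] unfolding lex_face_def by blast
qed

lemma lex_face_coords_unique:
  assumes "lex_face T" "sum c T = sum d T" "(\<Sum>w\<in>T. c w *\<^sub>R w) = (\<Sum>w\<in>T. d w *\<^sub>R w)" "w \<in> T"
  shows "c w = d w"
  using lex_face_independent[of T "\<lambda>w. c w - d w" w] assms
  by (simp add: sum_subtractf scaleR_diff_left)

text \<open>Only the coordinates in \<open>U\<close> carry a sign condition. The assumption
  \<open>pointed\<close> says that every lexicographically decreasing direction eventually violates
  one, which is what makes minimal coordinates exist.\<close>

context
  fixes U :: "'v set"
  assumes U: "U \<subseteq> V"
    and pointed: "\<And>d. dependence d \<Longrightarrow> lex_neg us d \<Longrightarrow> \<exists>u\<in>U. d u < 0"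
begin

text \<open>Vanishing off \<open>V\<close> makes equal coordinates equal as functions, which the
  finiteness of the basic ones relies on.\<close>

definition coords :: "'v \<Rightarrow> ('v \<Rightarrow> real) set" where
  "coords y = {c. (\<forall>w. w \<notin> V \<longrightarrow> c w = 0) \<and> sum c V = 1 \<and> (\<Sum>w\<in>V. c w *\<^sub>R w) = y \<and>
    (\<forall>w\<in>U. 0 \<le> c w)}"

text \<open>Basic solutions as in linear programming: the constrained coordinates that vanish
  determine all the others.\<close>

definition basic :: "('v \<Rightarrow> real) \<Rightarrow> bool" where
  "basic c \<longleftrightarrow>
    (\<forall>d. dependence d \<longrightarrow> (\<forall>u\<in>U. c u = 0 \<longrightarrow> d u = 0) \<longrightarrow> (\<forall>w\<in>V. d w = 0))"

lemma dependence_diff_coords: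
  "b \<in> coords y \<Longrightarrow> c \<in> coords y \<Longrightarrow> dependence (\<lambda>w. b w - c w)"
  by (simp add: coords_def dependence_def sum_subtractf scaleR_diff_left)

lemma coords_step:
  assumes "c \<in> coords y" "dependence d" "\<forall>u\<in>U. 0 \<le> c u + t * d u"
  shows "(\<lambda>w. if w \<in> V then c w + t * d w else 0) \<in> coords y"
proof -
  have "(\<Sum>w\<in>V. c w + t * d w) = 1"
    using assms by (simp add: coords_def dependence_def sum.distrib flip: sum_distrib_left)
  moreover have "(\<Sum>w\<in>V. (c w + t * d w) *\<^sub>R w) = (\<Sum>w\<in>V. c w *\<^sub>R w) + t *\<^sub>R (\<Sum>w\<in>V. d w *\<^sub>R w)"
    by (simp add: scaleR_add_left sum.distrib scaleR_sum_right)
  ultimately show ?thesis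
    using assms U by (auto simp: coords_def dependence_def cong: sum.cong)
qed

text \<open>A pivoting argument. If \<open>c\<close> is not basic, some dependence preserves its
  zeros in \<open>U\<close>, with the sign chosen to be decreasing. Following it until a coordinate
  in \<open>U\<close> first reaches zero shrinks the support in \<open>U\<close>.\<close>

lemma reduce_to_basic:
  "c \<in> coords y \<Longrightarrow> \<exists>b\<in>coords y. basic b \<and> (b = c \<or> lex_neg us (\<lambda>w. b w - c w))"
proof (induction "card {u \<in> U. c u \<noteq> 0}" arbitrary: c rule: less_induct)
  case less
  have finU: "finite U" using U by (rule finite_subset) simp
  show ?case
  proof (cases "basic c")
    case True
    then show ?thesis using less.prems by blast
  next
    case False
    then obtain d0 w where d0: "dependence d0" "\<forall>u\<in>U. c u = 0 \<longrightarrow> d0 u = 0" "w \<in> V" "d0 w \<noteq> 0"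
      unfolding basic_def by blast
    obtain d where d: "dependence d" "\<forall>u\<in>U. c u = 0 \<longrightarrow> d u = 0" "lex_neg us d"
    proof (cases "lex_neg us d0")
      case True
      then show ?thesis using d0 that by blast
    next
      case False
      then have "lex_neg us (\<lambda>u. - d0 u)" using lex_neg_total[of w us d0] d0 by blast
      then show ?thesis using d0 dependence_uminus[OF d0(1)] by (intro that[of "\<lambda>u. - d0 u"]) auto
    qed
    let ?N = "{u \<in> U. d u < 0}"
    \<comment> \<open>The ratio test: \<open>t\<close> is the longest step that keeps all
      coordinates in \<open>U\<close> nonnegative, and the minimizing \<open>u0\<close> drops to
      zero.\<close>
    define t where "t = Min ((\<lambda>u. c u / - d u) ` ?N)"
    have N: "finite ?N" "?N \<noteq> {}" using finU pointed[OF d(1,3)] by auto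
    have c_pos: "0 < c u" if "u \<in> ?N" for u
    proof -
      have "0 \<le> c u" "c u \<noteq> 0" using less.prems d(2) that by (auto simp: coords_def)
      then show ?thesis by simp
    qed
    have "t \<in> (\<lambda>u. c u / - d u) ` ?N" unfolding t_def using N by (intro Min_in) auto
    then obtain u0 where u0: "u0 \<in> ?N" "t = c u0 / - d u0" by blast
    have t_le: "t \<le> c u / - d u" if "u \<in> ?N" for u
      unfolding t_def using N that by (intro Min_le) auto
    have t_pos: "0 < t" unfolding u0(2) using c_pos[OF u0(1)] u0(1) by (intro divide_pos_pos) auto
    define b where "b w = (if w \<in> V then c w + t * d w else 0)" for w
    have nonneg: "0 \<le> c u + t * d u" if "u \<in> U" for u
    proof (cases "d u < 0")
      case True
      then show ?thesis using t_le[of u] that by (simp add: field_simps)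
    next
      case False
      then show ?thesis using t_pos less.prems that by (simp add: coords_def)
    qed
    have b: "b \<in> coords y"
      unfolding b_def using coords_step[OF less.prems d(1)] nonneg by blast
    have "{u \<in> U. b u \<noteq> 0} \<subset> {u \<in> U. c u \<noteq> 0}"
    proof
      show "{u \<in> U. b u \<noteq> 0} \<subseteq> {u \<in> U. c u \<noteq> 0}"
        using U d(2) by (auto simp: b_def)
      have "b u0 = 0" using u0 U by (auto simp: b_def)
      moreover have "c u0 \<noteq> 0" using c_pos[OF u0(1)] by simp
      ultimately show "{u \<in> U. b u \<noteq> 0} \<noteq> {u \<in> U. c u \<noteq> 0}" using u0(1) by auto
    qed
    then have "card {u \<in> U. b u \<noteq> 0} < card {u \<in> U. c u \<noteq> 0}"
      using finU by (intro psubset_card_mono) auto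
    from less.hyps[OF this b] obtain a where
      a: "a \<in> coords y" "basic a" "a = b \<or> lex_neg us (\<lambda>w. a w - b w)" by blast
    have "lex_neg us (\<lambda>w. t * d w)" using lex_neg_scale[OF t_pos] d(3) by blast
    then have "lex_neg us (\<lambda>w. b w - c w)"
      using lex_neg_cong[of us "\<lambda>w. b w - c w" "\<lambda>w. t * d w"] by (simp add: b_def)
    with a show ?thesis using lex_neg_trans by blast
  qed
qed

text \<open>Two basic solutions with the same support in \<open>U\<close> differ by a dependence
  that vanishes on the zeros of the first, hence by zero; so they are no more numerous than the
  supports.\<close>

lemma finite_basic_coords: "finite {b \<in> coords y. basic b}"
proof (rule finite_imageD)
  show "finite ((\<lambda>b. {u \<in> U. b u \<noteq> 0}) ` {b \<in> coords y. basic b})"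
    by (rule finite_subset[of _ "Pow V"]) (use U in auto)
  show "inj_on (\<lambda>b. {u \<in> U. b u \<noteq> 0}) {b \<in> coords y. basic b}"
  proof (rule inj_onI)
    fix a b assume ab: "a \<in> {b \<in> coords y. basic b}" "b \<in> {b \<in> coords y. basic b}"
      "{u \<in> U. a u \<noteq> 0} = {u \<in> U. b u \<noteq> 0}"
    then have "dependence (\<lambda>w. b w - a w)" "\<forall>u\<in>U. a u = 0 \<longrightarrow> b u - a u = 0"
      using dependence_diff_coords by auto
    then have "\<forall>w\<in>V. b w - a w = 0" using ab(1) unfolding basic_def by blast
    moreover have "\<forall>w. w \<notin> V \<longrightarrow> a w = 0 \<and> b w = 0" using ab(1,2) by (simp add: coords_def)
    ultimately show "a = b" by (intro ext) (metis eq_iff_diff_eq_0)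
  qed
qed

text \<open>The least of the finitely many basic solutions is minimal overall, since any coordinates
  are bounded below by basic ones.\<close>

lemma ex_lex_min_coords:
  assumes "c \<in> coords y"
  shows "\<exists>m\<in>coords y. \<forall>c\<in>coords y. \<not> lex_neg us (\<lambda>w. c w - m w)"
proof -
  let ?B = "{b \<in> coords y. basic b}" and ?R = "\<lambda>a b. lex_neg us (\<lambda>w. a w - b w)"
  have "?B \<noteq> {}" using reduce_to_basic[OF assms] by blast
  moreover have "asymp_on ?B ?R"
    using lex_neg_trans lex_neg_irrefl by (blast intro: asymp_onI)
  moreover have "transp_on ?B ?R"
    using lex_neg_trans by (blast intro: transp_onI)
  ultimately have "\<exists>m\<in>?B. \<forall>b\<in>?B. b \<noteq> m \<longrightarrow> \<not> ?R b m"
    by (intro Finite_Set.bex_min_element finite_basic_coords)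
  then obtain m where m: "m \<in> ?B" "\<forall>b\<in>?B. b \<noteq> m \<longrightarrow> \<not> ?R b m" by blast
  have "\<not> ?R c m" if c: "c \<in> coords y" for c
  proof
    assume "?R c m"
    from reduce_to_basic[OF c] obtain b where b: "b \<in> ?B" "b = c \<or> ?R b c" by blast
    with \<open>?R c m\<close> have "?R b m" using lex_neg_trans by blast
    moreover from this have "b \<noteq> m" using lex_neg_irrefl by blast
    ultimately show False using m b by blast
  qed
  with m show ?thesis by blast
qed

text \<open>Each point goes to the support of its minimal coordinates. That support is a face: a
  decreasing dependence nonnegative off it could be followed for a short step, against
  minimality.\<close>

lemma sign_hull_decomposition:
  "sign_hull U = (\<Union>T\<in>{T. lex_face T \<and> V - U \<subseteq> T}. open_piece T (T \<inter> U))"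
proof (intro equalityI subsetI)
  fix y assume "y \<in> sign_hull U"
  then obtain c where c: "y = (\<Sum>w\<in>V. c w *\<^sub>R w)" "sum c V = 1" "\<forall>w\<in>U. 0 \<le> c w"
    unfolding sign_hull_def by blast
  have "(\<lambda>w. if w \<in> V then c w else 0) \<in> coords y"
    using c U sum_extend_zero[OF subset_refl, of c] by (auto simp: coords_def)
  from ex_lex_min_coords[OF this] obtain m where
    m: "m \<in> coords y" "\<forall>c\<in>coords y. \<not> lex_neg us (\<lambda>w. c w - m w)" by blast
  \<comment> \<open>Unconstrained vertices always belong to \<open>T\<close>, whatever the sign of
    their coordinate.\<close>
  define T where "T = {u \<in> U. 0 < m u} \<union> (V - U)"
  have T: "T \<subseteq> V" using U by (auto simp: T_def)
  have "\<not> (dependence d \<and> lex_neg us d \<and> (\<forall>w\<in>V - T. 0 \<le> d w))" for d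
  proof
    assume d: "dependence d \<and> lex_neg us d \<and> (\<forall>w\<in>V - T. 0 \<le> d w)"
    have "\<exists>t>0. \<forall>u\<in>U. 0 \<le> m u + t * d u"
    proof (rule ex_small_nonneg_step)
      show "finite U" using U by (rule finite_subset) simp
      show "0 \<le> m u" if "u \<in> U" for u using m(1) that by (simp add: coords_def)
      show "0 \<le> d u" if "u \<in> U" "m u = 0" for u using d that U by (auto simp: T_def)
    qed
    then obtain t where t: "0 < t" "\<forall>u\<in>U. 0 \<le> m u + t * d u" by blast
    have "\<not> lex_neg us (\<lambda>w. (if w \<in> V then m w + t * d w else 0) - m w)"
      by (rule bspec[OF m(2) coords_step[OF m(1) conjunct1[OF d] t(2)]])
    also have "lex_neg us (\<lambda>w. (if w \<in> V then m w + t * d w else 0) - m w) \<longleftrightarrow> lex_neg us (\<lambda>w. t * d w)"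
      by (rule lex_neg_cong) simp
    finally show False using d t(1) by (simp add: lex_neg_scale)
  qed
  with T have "lex_face T" unfolding lex_face_def by blast
  moreover have "y \<in> open_piece T (T \<inter> U)"
  proof -
    have m0: "m w = 0" if "w \<notin> T" for w
    proof (cases "w \<in> V")
      case True
      then have "w \<in> U" "\<not> 0 < m w" using that by (auto simp: T_def)
      then show ?thesis using m(1) by (force simp: coords_def)
    qed (use m(1) in \<open>auto simp: coords_def\<close>)
    have "sum m T = 1" "(\<Sum>w\<in>T. m w *\<^sub>R w) = y"
      using sum.mono_neutral_left[of V T m] sum.mono_neutral_left[of V T "\<lambda>w. m w *\<^sub>R w"]
        T m0 m(1) by (auto simp: coords_def)
    then show ?thesis unfolding open_piece_def by (auto simp: T_def)
  qed
  ultimately show "y \<in> (\<Union>T\<in>{T. lex_face T \<and> V - U \<subseteq> T}. open_piece T (T \<inter> U))"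
    unfolding T_def by blast
next
  fix y assume "y \<in> (\<Union>T\<in>{T. lex_face T \<and> V - U \<subseteq> T}. open_piece T (T \<inter> U))"
  then obtain T c where T: "lex_face T" and c: "y = (\<Sum>w\<in>T. c w *\<^sub>R w)" "sum c T = 1"
    "\<forall>w\<in>T \<inter> U. 0 < c w"
    unfolding open_piece_def by blast
  have "T \<subseteq> V" using T by (simp add: lex_face_def)
  from sum_extend_zero[OF this, of c] c show "y \<in> sign_hull U"
    unfolding sign_hull_def
    by (intro CollectI exI[of _ "\<lambda>w. if w \<in> T then c w else 0"]) (auto simp: less_imp_le)
qed

text \<open>If a point lies in the pieces of \<open>S\<close> and \<open>T\<close>, then
  \<open>c - b\<close> is nonnegative off \<open>S\<close> and \<open>b - c\<close> off
  \<open>T\<close>. As both sets are faces, neither vector is smaller, so \<open>b = c\<close>, and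
  the positive coordinates in \<open>U\<close> recover the face.\<close>

lemma disjoint_open_pieces:
  "disjoint_family_on (\<lambda>T. open_piece T (T \<inter> U)) {T. lex_face T \<and> V - U \<subseteq> T}"
  unfolding disjoint_family_on_def
proof (intro ballI impI)
  fix S T assume S: "S \<in> {T. lex_face T \<and> V - U \<subseteq> T}" and T: "T \<in> {T. lex_face T \<and> V - U \<subseteq> T}"
    and "S \<noteq> T"
  show "open_piece S (S \<inter> U) \<inter> open_piece T (T \<inter> U) = {}"
  proof (rule ccontr)
    assume "open_piece S (S \<inter> U) \<inter> open_piece T (T \<inter> U) \<noteq> {}"
    then obtain y b0 c0 where
      b0: "y = (\<Sum>w\<in>S. b0 w *\<^sub>R w)" "sum b0 S = 1" "\<forall>w\<in>S \<inter> U. 0 < b0 w" and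
      c0: "y = (\<Sum>w\<in>T. c0 w *\<^sub>R w)" "sum c0 T = 1" "\<forall>w\<in>T \<inter> U. 0 < c0 w"
      unfolding open_piece_def by blast
    define b where "b w = (if w \<in> S then b0 w else 0)" for w
    define c where "c w = (if w \<in> T then c0 w else 0)" for w
    have sub: "S \<subseteq> V" "T \<subseteq> V" using S T by (auto simp: lex_face_def)
    have dep: "dependence (\<lambda>w. b w - c w)" "dependence (\<lambda>w. c w - b w)"
      using sum_extend_zero[OF sub(1), of b0] sum_extend_zero[OF sub(2), of c0] b0 c0
      by (simp_all add: dependence_def b_def c_def sum_subtractf scaleR_diff_left)
    have "\<forall>w\<in>V - S. 0 \<le> c w - b w"
    proof
      fix w assume w: "w \<in> V - S"
      then have "w \<in> U" using S by blast
      with w c0(3) show "0 \<le> c w - b w" by (auto simp: b_def c_def less_imp_le)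
    qed
    with S dep(2) have "\<not> lex_neg us (\<lambda>w. c w - b w)" unfolding lex_face_def by blast
    moreover have "\<forall>w\<in>V - T. 0 \<le> b w - c w"
    proof
      fix w assume w: "w \<in> V - T"
      then have "w \<in> U" using T by blast
      with w b0(3) show "0 \<le> b w - c w" by (auto simp: b_def c_def less_imp_le)
    qed
    with T dep(1) have "\<not> lex_neg us (\<lambda>w. b w - c w)" unfolding lex_face_def by blast
    ultimately have eq: "b w = c w" if "w \<in> V" for w
      using lex_neg_total[of w us "\<lambda>w. b w - c w"] that by auto
    have "w \<in> S \<longleftrightarrow> w \<in> T" if "w \<in> V" for w
    proof (cases "w \<in> U")
      case True
      then have "w \<in> S \<longleftrightarrow> b w \<noteq> 0" "w \<in> T \<longleftrightarrow> c w \<noteq> 0"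
        using b0(3) c0(3) by (auto simp: b_def c_def dest!: bspec[of _ _ w])
      then show ?thesis using eq[OF that] by simp
    next
      case False
      then show ?thesis using S T that by blast
    qed
    with sub \<open>S \<noteq> T\<close> show False by blast
  qed
qed

end

end

section \<open>Pieces of polytopes and vertex cones\<close>

context lex_triangulation
begin

lemma sign_hull_V: "sign_hull V = convex hull V"
  unfolding sign_hull_def by (subst convex_hull_finite) auto

text \<open>A decreasing dependence has a negative entry. Were \<open>v\<close> the only such place,
  dividing by \<open>- d v\<close> would write \<open>v\<close> as a convex combination of the other
  points.\<close>

lemma pointed_at_extreme:
  assumes "v \<in> V" "v \<notin> convex hull (V - {v})" "dependence d" "lex_neg us d"
  shows "\<exists>u\<in>V - {v}. d u < 0"
proof (rule ccontr)
  assume "\<not> (\<exists>u\<in>V - {v}. d u < 0)"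
  then have nonneg: "\<And>u. u \<in> V - {v} \<Longrightarrow> 0 \<le> d u" by (meson not_le_imp_less)
  with lex_neg_ex_neg[OF assms(4)] have neg: "d v < 0" by force
  have s: "d v + sum d (V - {v}) = 0" "d v *\<^sub>R v + (\<Sum>w\<in>V - {v}. d w *\<^sub>R w) = 0"
    using assms(1,3) sum.remove[of V v d] sum.remove[of V v "\<lambda>w. d w *\<^sub>R w"]
    by (simp_all add: dependence_def)
  have "(\<Sum>w\<in>V - {v}. (d w / - d v) *\<^sub>R w) \<in> convex hull (V - {v})"
  proof (rule convex_sum)
    have "(\<Sum>w\<in>V - {v}. d w / - d v) = sum d (V - {v}) / - d v"
      by (rule sum_divide_distrib[symmetric])
    also have "sum d (V - {v}) = - d v" using s(1) by linarith
    finally show "(\<Sum>w\<in>V - {v}. d w / - d v) = 1" using neg by simp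
    show "0 \<le> d w / - d v" if "w \<in> V - {v}" for w
      using nonneg[OF that] neg by (intro divide_nonneg_pos) auto
  qed (auto simp: hull_inc)
  moreover have "(\<Sum>w\<in>V - {v}. (d w / - d v) *\<^sub>R w) = (1 / - d v) *\<^sub>R (\<Sum>w\<in>V - {v}. d w *\<^sub>R w)"
    by (simp add: scaleR_sum_right)
  moreover have "(\<Sum>w\<in>V - {v}. d w *\<^sub>R w) = (- d v) *\<^sub>R v"
    using s(2) by (simp add: eq_neg_iff_add_eq_0 add.commute)
  ultimately show False using assms(2) neg by simp
qed

text \<open>The case \<open>U = V\<close>, where \<open>pointed\<close> holds because a decreasing
  dependence has a negative entry.\<close>

lemma convex_hull_pieces:
  "convex hull V = (\<Union>T\<in>{T. lex_face T}. open_piece T T)"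
  "disjoint_family_on (\<lambda>T. open_piece T T) {T. lex_face T}"
proof -
  have T: "T \<inter> V = T" if "T \<in> {T. lex_face T}" for T
    using that by (auto simp: lex_face_def)
  have pointed: "\<exists>u\<in>V. d u < 0" if "dependence d" "lex_neg us d" for d
    using that(2) by (rule lex_neg_ex_neg)
  show "convex hull V = (\<Union>T\<in>{T. lex_face T}. open_piece T T)"
    using sign_hull_decomposition[OF subset_refl pointed] T by (simp add: sign_hull_V)
  show "disjoint_family_on (\<lambda>T. open_piece T T) {T. lex_face T}"
    using disjoint_open_pieces[OF subset_refl pointed] T by (simp add: disjoint_family_on_def)
qed

end

text \<open>Dilating from \<open>v\<close> rescales the coordinates of the other points and lets
  that of \<open>v\<close> absorb the remainder, with either sign.\<close>

lemma vertex_cone_convex_hull: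
  assumes "v \<in> set us"
  shows "vertex_cone v (convex hull set us) = lex_triangulation.sign_hull us (set us - {v})"
proof -
  interpret lex_triangulation us .
  have split: "(\<Sum>w\<in>V. c w *\<^sub>R w) = c v *\<^sub>R v + (\<Sum>w\<in>V - {v}. c w *\<^sub>R w)"
    "sum c V = c v + sum c (V - {v})" for c
    using assms by (simp_all add: sum.remove)
  show ?thesis
  proof (intro equalityI subsetI)
    fix x assume "x \<in> vertex_cone v (convex hull V)"
    then obtain t u where x: "x = v + t *\<^sub>R (u - v)" "u \<in> convex hull V" "0 \<le> t"
      unfolding vertex_cone_def by blast
    then obtain c where c: "\<forall>w\<in>V. 0 \<le> c w" "sum c V = 1" "u = (\<Sum>w\<in>V. c w *\<^sub>R w)"
      by (auto simp: convex_hull_finite)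
    \<comment> \<open>The weight \<open>1 - t\<close> that goes to \<open>v\<close> is negative for
      \<open>t > 1\<close>.\<close>
    define b where "b w = t * c w + (if w = v then 1 - t else 0)" for w
    have "(\<Sum>w\<in>V. b w *\<^sub>R w) = (\<Sum>w\<in>V. t *\<^sub>R (c w *\<^sub>R w) + (if w = v then (1 - t) *\<^sub>R v else 0))"
      by (intro sum.cong) (auto simp: b_def scaleR_add_left)
    also have "\<dots> = t *\<^sub>R u + (1 - t) *\<^sub>R v"
      using assms by (simp add: sum.distrib c(3) scaleR_sum_right)
    also have "\<dots> = x" by (simp add: x algebra_simps)
    finally have "x = (\<Sum>w\<in>V. b w *\<^sub>R w)" ..
    moreover have "sum b V = 1"
      using assms c(2) by (simp add: b_def sum.distrib flip: sum_distrib_left)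
    moreover have "\<forall>w\<in>V - {v}. 0 \<le> b w" using c(1) x(3) by (auto simp: b_def)
    ultimately show "x \<in> sign_hull (V - {v})" unfolding sign_hull_def by blast
  next
    fix x assume "x \<in> sign_hull (V - {v})"
    then obtain c where c: "x = (\<Sum>w\<in>V. c w *\<^sub>R w)" "sum c V = 1" "\<forall>w\<in>V - {v}. 0 \<le> c w"
      unfolding sign_hull_def by blast
    \<comment> \<open>The dilation factor: normalizing the other coordinates by \<open>s\<close>
      gives the point \<open>u\<close>. For \<open>s = 0\<close> the point is \<open>v\<close>
      itself.\<close>
    define s where "s = sum c (V - {v})"
    have s0: "0 \<le> s" unfolding s_def using c(3) by (intro sum_nonneg) auto
    have cv: "c v = 1 - s" using c(2) split(2)[of c] by (simp add: s_def)
    show "x \<in> vertex_cone v (convex hull V)"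
    proof (cases "s = 0")
      case True
      then have "\<forall>w\<in>V - {v}. c w = 0"
        using c(3) sum_nonneg_eq_0_iff[of "V - {v}" c] by (auto simp: s_def)
      then have "x = v + 0 *\<^sub>R (v - v)" using c(1) split(1)[of c] cv True by simp
      then show ?thesis
        unfolding vertex_cone_def using assms hull_inc[of v V] by blast
    next
      case False
      define u where "u = (\<Sum>w\<in>V - {v}. (c w / s) *\<^sub>R w)"
      have "u \<in> convex hull V"
        unfolding u_def
      proof (rule convex_sum)
        show "(\<Sum>w\<in>V - {v}. c w / s) = 1"
          using False by (simp add: s_def flip: sum_divide_distrib)
        show "0 \<le> c w / s" if "w \<in> V - {v}" for w using c(3) s0 that by simp
      qed (auto simp: hull_inc)
      moreover have "s *\<^sub>R u = (\<Sum>w\<in>V - {v}. c w *\<^sub>R w)"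
        using False by (simp add: u_def scaleR_sum_right)
      then have "x = v + s *\<^sub>R (u - v)"
        using c(1) split(1)[of c] cv by (simp add: algebra_simps)
      ultimately show ?thesis unfolding vertex_cone_def using s0 by blast
    qed
  qed
qed

section \<open>Integer generators for the cones at rational vertices\<close>

lemma rational_common_denominator:
  assumes "finite V" "\<And>v. v \<in> V \<Longrightarrow> rational_vec v"
  shows "\<exists>N>0. \<forall>v\<in>V. \<exists>a. of_int_vec a = real N *\<^sub>R (v :: real ^ 'd)"
proof -
  have finI: "\<exists>N>0. \<forall>x\<in>X. real N * x \<in> \<int>" if "finite X" "X \<subseteq> \<rat>" for X :: "real set"
    using that
  proof (induction X)
    case empty
    show ?case by (auto intro: exI[of _ 1])
  next
    case (insert x X)
    then obtain N where N: "N > 0" "\<forall>x\<in>X. real N * x \<in> \<int>" by auto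
    from insert.prems obtain a b :: int where "b > 0" "x = of_int a / of_int b"
      by (auto elim: Rats_cases')
    then have ab: "b > 0" "real (nat b) * x = of_int a" by simp_all
    have "real (N * nat b) * x \<in> \<int>"
      using ab(2) by (simp add: mult.assoc)
    moreover have "real (N * nat b) * y \<in> \<int>" if "y \<in> X" for y
      using N(2) that by (metis Ints_mult Ints_of_nat mult.assoc mult.commute of_nat_mult)
    ultimately show ?case using N(1) ab(1) by (intro exI[of _ "N * nat b"]) auto
  qed
  have "\<exists>N>0. \<forall>x\<in>(\<Union>v\<in>V. range (vec_nth v)). real N * x \<in> \<int>"
    using assms by (intro finI) (auto simp: rational_vec_def)
  then obtain N where N: "N > 0" "\<And>v i. v \<in> V \<Longrightarrow> real N * v $ i \<in> \<int>" by blast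
  have "of_int_vec (\<chi> i. \<lfloor>real N * v $ i\<rfloor>) = real N *\<^sub>R v" if "v \<in> V" for v
    using N(2)[OF that] by (simp add: of_int_vec_def vec_eq_iff)
  with N(1) show ?thesis by blast
qed

text \<open>A common multiple \<open>N\<close> makes every \<open>\<iota> v\<close> the lattice
  point \<open>N v\<close>, so \<open>\<iota> w - \<iota> v\<close> is an integer vector along the
  ray from \<open>v\<close> through \<open>w\<close>.\<close>

locale rational_lex_triangulation = lex_triangulation us
  for us :: "(real ^ 'd) list" +
  fixes N :: nat and \<iota> :: "real ^ 'd \<Rightarrow> int ^ 'd"
  assumes N_pos: "0 < N"
    and of_int_vec_\<iota>: "v \<in> V \<Longrightarrow> of_int_vec (\<iota> v) = real N *\<^sub>R v"
begin

text \<open>The case \<open>U = V - {v}\<close>: containing all unconstrained points means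
  containing \<open>v\<close>.\<close>

lemma vertex_cone_pieces:
  assumes "v \<in> V" "v \<notin> convex hull (V - {v})"
  shows "vertex_cone v (convex hull V) = (\<Union>T\<in>{T. lex_face T \<and> v \<in> T}. open_piece T (T - {v}))"
    and "disjoint_family_on (\<lambda>T. open_piece T (T - {v})) {T. lex_face T \<and> v \<in> T}"
proof -
  have faces: "{T. lex_face T \<and> V - (V - {v}) \<subseteq> T} = {T. lex_face T \<and> v \<in> T}"
    using assms(1) by auto
  have T: "T \<inter> (V - {v}) = T - {v}" if "T \<in> {T. lex_face T \<and> v \<in> T}" for T
    using that by (auto simp: lex_face_def)
  have "sign_hull (V - {v}) = (\<Union>T\<in>{T. lex_face T \<and> v \<in> T}. open_piece T (T \<inter> (V - {v})))"
    unfolding faces[symmetric]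
    by (rule sign_hull_decomposition[OF Diff_subset]) (rule pointed_at_extreme[OF assms])
  then show "vertex_cone v (convex hull V) = (\<Union>T\<in>{T. lex_face T \<and> v \<in> T}. open_piece T (T - {v}))"
    unfolding vertex_cone_convex_hull[OF assms(1)] using T by simp
  have "disjoint_family_on (\<lambda>T. open_piece T (T \<inter> (V - {v}))) {T. lex_face T \<and> v \<in> T}"
    unfolding faces[symmetric]
    by (rule disjoint_open_pieces[OF Diff_subset]) (rule pointed_at_extreme[OF assms])
  then show "disjoint_family_on (\<lambda>T. open_piece T (T - {v})) {T. lex_face T \<and> v \<in> T}"
    using T by (simp add: disjoint_family_on_def)
qed

lemma inj_on_generators:
  assumes "v \<in> V"
  shows "inj_on (\<lambda>w. \<iota> w - \<iota> v) V"
proof (rule inj_onI)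
  fix w w' assume w: "w \<in> V" "w' \<in> V" "\<iota> w - \<iota> v = \<iota> w' - \<iota> v"
  then have "of_int_vec (\<iota> w) = of_int_vec (\<iota> w')" by simp
  then show "w = w'" using w N_pos by (simp add: of_int_vec_\<iota>)
qed

lemma sum_generators:
  assumes "v \<in> V" "T \<subseteq> V"
  shows "(\<Sum>u\<in>(\<lambda>w. \<iota> w - \<iota> v) ` T. c u *\<^sub>R of_int_vec u) =
    (\<Sum>w\<in>T. (real N * c (\<iota> w - \<iota> v)) *\<^sub>R (w - v))"
proof -
  have "(\<Sum>u\<in>(\<lambda>w. \<iota> w - \<iota> v) ` T. c u *\<^sub>R of_int_vec u) =
    (\<Sum>w\<in>T. c (\<iota> w - \<iota> v) *\<^sub>R of_int_vec (\<iota> w - \<iota> v))"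
    by (rule sum.reindex_cong[OF inj_on_subset[OF inj_on_generators[OF assms(1)] assms(2)]]) simp_all
  also have "\<dots> = (\<Sum>w\<in>T. (real N * c (\<iota> w - \<iota> v)) *\<^sub>R (w - v))"
    using assms by (intro sum.cong refl)
      (auto simp: of_int_vec_\<iota> subset_iff mult.commute simp flip: scaleR_diff_right)
  finally show ?thesis .
qed

text \<open>Summing to \<open>1\<close> eliminates the free coordinate of \<open>v\<close>. The
  others are positive and equal \<open>N\<close> times the cone coefficients, so all generators are
  of the open kind.\<close>

lemma half_open_cone_eq_open_piece:
  assumes "lex_face T" "v \<in> T"
  shows "half_open_cone v {} ((\<lambda>w. \<iota> w - \<iota> v) ` (T - {v})) = open_piece T (T - {v})"
proof -
  let ?g = "\<lambda>w. \<iota> w - \<iota> v"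
  have T: "T \<subseteq> V" "finite T" "v \<in> V"
    using assms lex_face_finite by (auto simp: lex_face_def)
  have split: "(\<Sum>w\<in>T. c w *\<^sub>R w) = v + (\<Sum>w\<in>T - {v}. c w *\<^sub>R (w - v))" if "sum c T = 1" for c
  proof -
    have "(\<Sum>w\<in>T. c w *\<^sub>R w) = (\<Sum>w\<in>T. c w *\<^sub>R (w - v)) + sum c T *\<^sub>R v"
      by (simp add: scaleR_diff_right sum_subtractf scaleR_sum_left)
    also have "(\<Sum>w\<in>T. c w *\<^sub>R (w - v)) = (\<Sum>w\<in>T - {v}. c w *\<^sub>R (w - v))"
      using T by (intro sum.mono_neutral_right) auto
    finally show ?thesis by (simp add: that)
  qed
  have gen: "(\<Sum>u\<in>?g ` (T - {v}). c u *\<^sub>R of_int_vec u) =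
    (\<Sum>w\<in>T - {v}. (real N * c (?g w)) *\<^sub>R (w - v))" for c
    using T by (intro sum_generators) auto
  show ?thesis
  proof (intro equalityI subsetI)
    fix x assume "x \<in> half_open_cone v {} (?g ` (T - {v}))"
    then obtain c where c: "x = v + (\<Sum>w\<in>T - {v}. (real N * c (?g w)) *\<^sub>R (w - v))"
      "\<forall>w\<in>T - {v}. 0 < c (?g w)"
      unfolding half_open_cone_def by (auto simp: gen)
    \<comment> \<open>The value at \<open>v\<close> is forced by the total weight
      \<open>1\<close>.\<close>
    define b where "b = (\<lambda>w. real N * c (?g w))(v := 1 - (\<Sum>w\<in>T - {v}. real N * c (?g w)))"
    have "sum b T = b v + sum b (T - {v})"
      using T assms by (simp add: sum.remove)
    also have "sum b (T - {v}) = (\<Sum>w\<in>T - {v}. real N * c (?g w))"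
      by (intro sum.cong) (auto simp: b_def)
    finally have "sum b T = 1" by (simp add: b_def)
    moreover have "(\<Sum>w\<in>T - {v}. b w *\<^sub>R (w - v)) =
        (\<Sum>w\<in>T - {v}. (real N * c (?g w)) *\<^sub>R (w - v))"
      by (intro sum.cong) (auto simp: b_def)
    ultimately have "x = (\<Sum>w\<in>T. b w *\<^sub>R w)" using split[of b] c(1) by simp
    moreover have "\<forall>w\<in>T - {v}. 0 < b w" using c(2) N_pos by (simp add: b_def)
    ultimately show "x \<in> open_piece T (T - {v})"
      using \<open>sum b T = 1\<close> unfolding open_piece_def by blast
  next
    fix x assume "x \<in> open_piece T (T - {v})"
    then obtain b where b: "x = (\<Sum>w\<in>T. b w *\<^sub>R w)" "sum b T = 1" "\<forall>w\<in>T - {v}. 0 < b w"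
      unfolding open_piece_def by blast
    \<comment> \<open>Cone coefficients are indexed by generators; inverting the generator map
      recovers the vertex.\<close>
    define c where "c u = b (inv_into V ?g u) / real N" for u
    have c: "real N * c (?g w) = b w" if "w \<in> T" for w
    proof -
      have "inv_into V ?g (?g w) = w"
        using that T by (intro inv_into_f_f[OF inj_on_generators[OF T(3)]]) auto
      then show ?thesis using N_pos by (simp add: c_def)
    qed
    have "x = v + (\<Sum>u\<in>?g ` (T - {v}). c u *\<^sub>R of_int_vec u)"
      unfolding gen using b(1) split[OF b(2)] c by simp
    moreover have "\<forall>u\<in>?g ` (T - {v}). 0 < c u"
    proof
      fix u assume "u \<in> ?g ` (T - {v})"
      then obtain w where w: "w \<in> T - {v}" "u = ?g w" by blast
      then have "0 < real N * c u" using b(3) c by simp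
      then show "0 < c u" by (simp add: zero_less_mult_iff)
    qed
    ultimately show "x \<in> half_open_cone v {} (?g ` (T - {v}))"
      unfolding half_open_cone_def by auto
  qed
qed

text \<open>A linear relation among the generators becomes an affine dependence on \<open>T\<close>
  once \<open>v\<close> receives minus the sum of its coefficients, and a face admits only the zero
  one.\<close>

lemma simplicial_generators_lex_face:
  assumes "lex_face T" "v \<in> T"
  shows "simplicial_generators {} ((\<lambda>w. \<iota> w - \<iota> v) ` (T - {v}))"
proof -
  let ?g = "\<lambda>w. \<iota> w - \<iota> v" and ?G = "(\<lambda>w. \<iota> w - \<iota> v) ` (T - {v})"
  have T: "T \<subseteq> V" "finite T" "v \<in> V"
    using assms lex_face_finite by (auto simp: lex_face_def)
  have "independent (of_int_vec ` ?G)"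
  proof
    assume "dependent (of_int_vec ` ?G)"
    then obtain a x where a: "x \<in> of_int_vec ` ?G" "a x \<noteq> 0" "(\<Sum>x\<in>of_int_vec ` ?G. a x *\<^sub>R x) = 0"
      using T(2) by (subst (asm) dependent_finite) blast+
    then obtain w where w: "w \<in> T - {v}" "x = of_int_vec (?g w)" by blast
    define c where "c w = real N * a (of_int_vec (?g w))" for w
    have "(\<Sum>x\<in>of_int_vec ` ?G. a x *\<^sub>R x) = (\<Sum>u\<in>?G. a (of_int_vec u) *\<^sub>R of_int_vec u)"
      by (rule sum.reindex_cong[OF inj_on_subset[OF inj_of_int_vec]]) auto
    also have "\<dots> = (\<Sum>w\<in>T - {v}. c w *\<^sub>R (w - v))"
      unfolding c_def using T by (intro sum_generators) auto
    finally have 0: "(\<Sum>w\<in>T - {v}. c w *\<^sub>R (w - v)) = 0" using a(3) by simp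
    define d where "d = c(v := - sum c (T - {v}))"
    have eq: "sum d (T - {v}) = sum c (T - {v})"
      "(\<Sum>w\<in>T - {v}. d w *\<^sub>R w) = (\<Sum>w\<in>T - {v}. c w *\<^sub>R w)"
      by (auto intro!: sum.cong simp: d_def)
    have "sum d T = 0"
      using T assms(2) eq(1) by (simp add: sum.remove) (simp add: d_def)
    moreover have "(\<Sum>w\<in>T. d w *\<^sub>R w) = 0"
    proof -
      have "(\<Sum>w\<in>T. d w *\<^sub>R w) = d v *\<^sub>R v + (\<Sum>w\<in>T - {v}. c w *\<^sub>R w)"
        using T assms(2) eq(2) by (simp add: sum.remove)
      also have "\<dots> = (\<Sum>w\<in>T - {v}. c w *\<^sub>R (w - v))"
        by (simp add: d_def scaleR_diff_right sum_subtractf scaleR_sum_left)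
      finally show ?thesis using 0 by simp
    qed
    ultimately have "d w = 0" using lex_face_independent[OF assms(1)] w(1) by blast
    then show False using w a(2) N_pos by (simp add: d_def c_def)
  qed
  then show ?thesis using T by (simp add: simplicial_generators_def)
qed

lemma half_open_decomposition_vertex_cone:
  assumes "v \<in> V" "rational_vec v" "v \<notin> convex hull (V - {v})"
  shows "half_open_decomposition (vertex_cone v (convex hull V)) v
    ((\<lambda>T. ({}, (\<lambda>w. \<iota> w - \<iota> v) ` (T - {v}))) ` {T. lex_face T \<and> v \<in> T})"
proof -
  let ?\<T> = "{T. lex_face T \<and> v \<in> T}" and ?G = "\<lambda>T. (\<lambda>w. \<iota> w - \<iota> v) ` (T - {v})"
  note pieces = vertex_cone_pieces[OF assms(1,3)]
  have cone: "half_open_cone v {} (?G T) = open_piece T (T - {v})" if "T \<in> ?\<T>" for T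
    using half_open_cone_eq_open_piece that by simp
  have "disjoint_family_on (\<lambda>(A, B). half_open_cone v A B) ((\<lambda>T. ({}, ?G T)) ` ?\<T>)"
    unfolding disjoint_family_on_def
  proof (intro ballI impI)
    fix p q :: "(int ^ 'd) set \<times> (int ^ 'd) set"
    assume p: "p \<in> (\<lambda>T. ({}, ?G T)) ` ?\<T>" and q: "q \<in> (\<lambda>T. ({}, ?G T)) ` ?\<T>" and "p \<noteq> q"
    then obtain S T where ST: "S \<in> ?\<T>" "T \<in> ?\<T>" "p = ({}, ?G S)" "q = ({}, ?G T)" "S \<noteq> T" by blast
    then have "open_piece S (S - {v}) \<inter> open_piece T (T - {v}) = {}"
      using pieces(2) unfolding disjoint_family_on_def by blast
    then show "(case p of (A, B) \<Rightarrow> half_open_cone v A B) \<inter> (case q of (A, B) \<Rightarrow> half_open_cone v A B) = {}"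
      using ST(3,4) cone[OF ST(1)] cone[OF ST(2)] by simp
  qed
  moreover have "(\<Union>(A, B)\<in>(\<lambda>T. ({}, ?G T)) ` ?\<T>. half_open_cone v A B) = vertex_cone v (convex hull V)"
    unfolding pieces(1) using cone by simp
  moreover have "finite ?\<T>" using finite_lex_faces by (rule rev_finite_subset) auto
  ultimately show ?thesis
    using assms(2) simplicial_generators_lex_face by (auto simp: half_open_decomposition_def)
qed

text \<open>Two coordinates without sign condition can trade weight at will, so the piece is
  invariant along the direction \<open>w - w'\<close>.\<close>

lemma open_piece_translate:
  assumes "T \<subseteq> V" "w \<in> T - I" "w' \<in> T - I" "w \<noteq> w'" "I \<subseteq> T"
  shows "(+) (of_int_vec (\<iota> w - \<iota> w')) ` open_piece T I = open_piece T I"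
proof -
  have fin: "finite T" using assms(1) by (rule finite_subset) simp
  have shift: "x + t *\<^sub>R (w - w') \<in> open_piece T I" if "x \<in> open_piece T I" for x t
  proof -
    from that obtain c where c: "x = (\<Sum>w\<in>T. c w *\<^sub>R w)" "sum c T = 1" "\<forall>w\<in>I. 0 < c w"
      unfolding open_piece_def by blast
    define e where "e u = (if u = w then t else 0) - (if u = w' then t else 0)" for u
    have "sum e T = 0" using fin assms(2,3) by (simp add: e_def sum_subtractf)
    then have "(\<Sum>u\<in>T. c u + e u) = 1" using c(2) by (simp add: sum.distrib)
    moreover have "(\<Sum>u\<in>T. e u *\<^sub>R u) = (\<Sum>u\<in>T. (if u = w then t *\<^sub>R w else 0) - (if u = w' then t *\<^sub>R w' else 0))"
      by (intro sum.cong) (auto simp: e_def)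
    then have "(\<Sum>u\<in>T. e u *\<^sub>R u) = t *\<^sub>R (w - w')"
      using fin assms(2,3) by (simp add: sum_subtractf scaleR_diff_right)
    then have "x + t *\<^sub>R (w - w') = (\<Sum>u\<in>T. (c u + e u) *\<^sub>R u)"
      by (simp add: c(1) scaleR_add_left sum.distrib)
    moreover have "\<forall>u\<in>I. 0 < c u + e u" using c(3) assms(2,3) by (auto simp: e_def)
    ultimately show ?thesis
      unfolding open_piece_def by (intro CollectI exI[of _ "\<lambda>u. c u + e u"]) simp
  qed
  have u: "of_int_vec (\<iota> w - \<iota> w') = real N *\<^sub>R (w - w')"
    using assms by (simp add: of_int_vec_\<iota> scaleR_diff_right subset_iff)
  show ?thesis
  proof (intro equalityI subsetI)
    fix x assume "x \<in> (+) (of_int_vec (\<iota> w - \<iota> w')) ` open_piece T I"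
    then obtain y where "y \<in> open_piece T I" "x = y + real N *\<^sub>R (w - w')"
      unfolding u by (auto simp: add.commute)
    then show "x \<in> open_piece T I" using shift by simp
  next
    fix x assume "x \<in> open_piece T I"
    from shift[OF this, of "- real N"] show "x \<in> (+) (of_int_vec (\<iota> w - \<iota> w')) ` open_piece T I"
      unfolding u by (rule rev_image_eqI) simp
  qed
qed

end

section \<open>Brion's formula\<close>

context rational_lex_triangulation
begin

lemma torsion_open_piece:
  fixes \<phi> :: "int ^ 'd \<Rightarrow> 'g::ab_group_add"
  assumes hom: "\<And>a b. \<phi> (a + b) = \<phi> a + \<phi> b"
    and "T \<subseteq> V" "I \<subseteq> T" "w \<in> T - I" "w' \<in> T - I" "w \<noteq> w'"
  shows "laurent_localization.torsion_series (denominators \<phi>)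
    (lattice_series \<phi> (open_piece T I) :: int ^ 'd \<Rightarrow> ('g, 'r::comm_ring_1) group_ring)"
proof (rule torsion_lattice_series[OF hom])
  have "w \<in> V" "w' \<in> V" using assms by auto
  then have "of_int_vec (\<iota> w - \<iota> w') \<noteq> 0"
    using assms(6) N_pos by (simp add: of_int_vec_\<iota>)
  then show "\<iota> w - \<iota> w' \<noteq> 0" by auto
  show "(+) (of_int_vec (\<iota> w - \<iota> w')) ` open_piece T I = open_piece T I"
    using assms by (intro open_piece_translate)
qed

text \<open>The sum expands the product over \<open>T\<close> of \<open>[c w > 0] - 1\<close>, where
  \<open>c\<close> are the coordinates of the lattice point; some factor vanishes.\<close>

lemma alternating_sum_open_pieces:
  assumes T: "lex_face T"
  shows "(\<Sum>I\<in>Pow T. (- 1) ^ card (T - I) * lattice_series \<phi> (open_piece T I) \<alpha>) =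
    (0 :: ('g::ab_group_add, 'r::comm_ring_1) group_ring)"
proof (cases "of_int_vec \<alpha> \<in> open_piece T {}")
  \<comment> \<open>Without sign conditions the piece is the affine hull of \<open>T\<close>, which
    contains all the others.\<close>
  case False
  then have "of_int_vec \<alpha> \<notin> open_piece T I" for I unfolding open_piece_def by blast
  then show ?thesis by (simp add: lattice_series_def)
next
  case True
  then obtain c where c: "of_int_vec \<alpha> = (\<Sum>w\<in>T. c w *\<^sub>R w)" "sum c T = 1"
    unfolding open_piece_def by blast
  have fin: "finite T" using T by (rule lex_face_finite)
  define x :: "real ^ 'd \<Rightarrow> ('g, 'r) group_ring" where "x w = (if 0 < c w then 1 else 0)" for w
  define s :: "('g, 'r) group_ring" where "s = Poly_Mapping.single (\<phi> \<alpha>) 1"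
  \<comment> \<open>Affine independence makes \<open>c\<close> the only coordinates on
    \<open>T\<close>, so membership can be tested on them.\<close>
  have iff: "of_int_vec \<alpha> \<in> open_piece T I \<longleftrightarrow> (\<forall>w\<in>I. 0 < c w)" if I: "I \<subseteq> T" for I
  proof
    assume "of_int_vec \<alpha> \<in> open_piece T I"
    then obtain d where d: "of_int_vec \<alpha> = (\<Sum>w\<in>T. d w *\<^sub>R w)" "sum d T = 1" "\<forall>w\<in>I. 0 < d w"
      unfolding open_piece_def by blast
    have "c w = d w" if "w \<in> T" for w
    proof (rule lex_face_coords_unique[OF T _ _ that])
      show "sum c T = sum d T" using c(2) d(2) by simp
      show "(\<Sum>w\<in>T. c w *\<^sub>R w) = (\<Sum>w\<in>T. d w *\<^sub>R w)"
        by (rule trans[OF c(1)[symmetric] d(1)])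
    qed
    then show "\<forall>w\<in>I. 0 < c w" using d(3) I by auto
  next
    assume "\<forall>w\<in>I. 0 < c w"
    then show "of_int_vec \<alpha> \<in> open_piece T I" unfolding open_piece_def using c by blast
  qed
  have series: "lattice_series \<phi> (open_piece T I) \<alpha> = prod x I * s" if I: "I \<subseteq> T" for I
  proof (cases "\<forall>w\<in>I. 0 < c w")
    case True
    then show ?thesis by (simp add: lattice_series_def iff[OF I] s_def x_def)
  next
    case False
    moreover have "finite I" using I fin by (rule finite_subset)
    ultimately have "prod x I = 0" by (auto simp: x_def intro!: prod_zero)
    moreover have "of_int_vec \<alpha> \<notin> open_piece T I" using False iff[OF I] by blast
    ultimately show ?thesis by (simp add: lattice_series_def)
  qed
  \<comment> \<open>Nonpositive coordinates could not sum to \<open>1\<close>.\<close>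
  have "\<exists>w\<in>T. 0 < c w"
    using c(2) sum_nonpos[of T c] by (force simp: not_less)
  then have "(\<Prod>w\<in>T. x w + (- 1)) = 0"
    using fin by (auto simp: x_def intro!: prod_zero)
  moreover have "(\<Prod>w\<in>T. x w + (- 1)) = (\<Sum>I\<in>Pow T. prod x I * (- 1) ^ card (T - I))"
    unfolding prod_add[OF fin] by simp
  moreover have "(\<Sum>I\<in>Pow T. (- 1) ^ card (T - I) * lattice_series \<phi> (open_piece T I) \<alpha>) =
      (\<Sum>I\<in>Pow T. prod x I * (- 1) ^ card (T - I)) * s"
    unfolding sum_distrib_right by (intro sum.cong) (simp_all add: series ac_simps)
  ultimately show ?thesis by simp
qed

text \<open>In the alternating sum, \<open>T\<close> enters with sign \<open>+\<close> and each
  \<open>T - {v}\<close> with sign \<open>-\<close>. Every other index set omits two vertices, so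
  its piece is invariant under a translation and its series is torsion.\<close>

lemma open_simplex_brion:
  fixes \<phi> :: "int ^ 'd \<Rightarrow> 'g::ab_group_add"
  assumes hom: "\<And>a b. \<phi> (a + b) = \<phi> a + \<phi> b" and T: "lex_face T"
  shows "laurent_localization.torsion_series (denominators \<phi>)
    (\<lambda>\<alpha>. (\<Sum>v\<in>T. lattice_series \<phi> (open_piece T (T - {v})) \<alpha>) -
      (lattice_series \<phi> (open_piece T T) \<alpha> :: ('g, 'r::comm_ring_1) group_ring))"
proof -
  interpret L: laurent_localization
    "denominators \<phi> :: ('d, ('g, 'r::comm_ring_1) group_ring) laurent set"
    by (rule laurent_localization_denominators)
  have fin: "finite T" and TV: "T \<subseteq> V" using T lex_face_finite by (auto simp: lex_face_def)
  define F :: "(real ^ 'd) set \<Rightarrow> int ^ 'd \<Rightarrow> ('g, 'r) group_ring" where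
    "F I \<alpha> = (- 1) ^ card (T - I) * lattice_series \<phi> (open_piece T I) \<alpha>" for I \<alpha>
  \<comment> \<open>The index sets that omit at most one vertex.\<close>
  define B where "B = insert T ((\<lambda>v. T - {v}) ` T)"
  have rest: "L.torsion_series (F I)" if "I \<in> Pow T - B" for I
  proof -
    have "I \<subseteq> T" "I \<noteq> T" using that by (auto simp: B_def)
    then obtain w where w: "w \<in> T - I" by blast
    with that have "I \<noteq> T - {w}" by (auto simp: B_def)
    with \<open>I \<subseteq> T\<close> w obtain w' where "w' \<in> T - I" "w \<noteq> w'" by blast
    then have "L.torsion_series (lattice_series \<phi> (open_piece T I))"
      using w \<open>I \<subseteq> T\<close> TV by (intro torsion_open_piece[OF hom])
    then show ?thesis unfolding F_def by (rule L.torsion_series_scale)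
  qed
  have "(\<Sum>v\<in>T. lattice_series \<phi> (open_piece T (T - {v})) \<alpha>) - lattice_series \<phi> (open_piece T T) \<alpha> =
    (\<Sum>I\<in>Pow T - B. F I \<alpha>)" for \<alpha>
  proof -
    have "inj_on (\<lambda>v. T - {v}) T" by (auto simp: inj_on_def)
    moreover have "T \<notin> (\<lambda>v. T - {v}) ` T" by blast
    ultimately have "(\<Sum>I\<in>B. F I \<alpha>) = F T \<alpha> + (\<Sum>v\<in>T. F (T - {v}) \<alpha>)"
      using fin by (simp add: B_def sum.reindex)
    also have "(\<Sum>v\<in>T. F (T - {v}) \<alpha>) = (\<Sum>v\<in>T. - lattice_series \<phi> (open_piece T (T - {v})) \<alpha>)"
    proof (rule sum.cong)
      fix v assume "v \<in> T"
      then have "T - (T - {v}) = {v}" by blast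
      then show "F (T - {v}) \<alpha> = - lattice_series \<phi> (open_piece T (T - {v})) \<alpha>"
        by (simp add: F_def)
    qed simp
    finally have "(\<Sum>I\<in>B. F I \<alpha>) = lattice_series \<phi> (open_piece T T) \<alpha> -
        (\<Sum>v\<in>T. lattice_series \<phi> (open_piece T (T - {v})) \<alpha>)"
      by (simp add: F_def sum_negf)
    moreover have "(\<Sum>I\<in>Pow T. F I \<alpha>) = 0"
      unfolding F_def by (rule alternating_sum_open_pieces[OF T])
    moreover have "(\<Sum>I\<in>Pow T. F I \<alpha>) = (\<Sum>I\<in>Pow T - B. F I \<alpha>) + (\<Sum>I\<in>B. F I \<alpha>)"
      using fin by (intro sum.subset_diff) (auto simp: B_def)
    ultimately have "(\<Sum>I\<in>Pow T - B. F I \<alpha>) = - (lattice_series \<phi> (open_piece T T) \<alpha> -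
        (\<Sum>v\<in>T. lattice_series \<phi> (open_piece T (T - {v})) \<alpha>))"
      by (simp only: eq_neg_iff_add_eq_0)
    then show ?thesis by (simp only: minus_diff_eq)
  qed
  then show ?thesis using L.torsion_series_sum[of "Pow T - B" F] rest by simp
qed

text \<open>Decomposing both polytope and cones and exchanging the sums over \<open>v\<close> and
  over the faces containing \<open>v\<close> leaves a sum over faces of the one-simplex
  differences.\<close>

lemma torsion_vertex_cones_minus_polytope:
  fixes \<phi> :: "int ^ 'd \<Rightarrow> 'g::ab_group_add"
  assumes hom: "\<And>a b. \<phi> (a + b) = \<phi> a + \<phi> b"
    and extreme: "\<And>v. v \<in> V \<Longrightarrow> v \<notin> convex hull (V - {v})"
  shows "laurent_localization.torsion_series (denominators \<phi>)
    (\<lambda>\<alpha>. (\<Sum>v\<in>V. lattice_series \<phi> (vertex_cone v (convex hull V)) \<alpha>) -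
      (lattice_series \<phi> (convex hull V) \<alpha> :: ('g, 'r::comm_ring_1) group_ring))"
proof -
  interpret L: laurent_localization
    "denominators \<phi> :: ('d, ('g, 'r::comm_ring_1) group_ring) laurent set"
    by (rule laurent_localization_denominators)
  let ?\<T> = "{T. lex_face T}"
  let ?s = "\<lambda>Q \<alpha>. lattice_series \<phi> Q \<alpha> :: ('g, 'r) group_ring"
  have cone: "?s (vertex_cone v (convex hull V)) \<alpha> = (\<Sum>T\<in>{T \<in> ?\<T>. v \<in> T}. ?s (open_piece T (T - {v})) \<alpha>)"
    if "v \<in> V" for v \<alpha>
    unfolding vertex_cone_pieces(1)[OF that extreme[OF that]]
    using lattice_series_disjoint_union[OF _ vertex_cone_pieces(2)[OF that extreme[OF that]]]
      finite_subset[OF _ finite_lex_faces, of "{T. lex_face T \<and> v \<in> T}"]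
    by auto
  have "(\<Sum>v\<in>V. ?s (vertex_cone v (convex hull V)) \<alpha>) - ?s (convex hull V) \<alpha> =
    (\<Sum>T\<in>?\<T>. (\<Sum>v\<in>T. ?s (open_piece T (T - {v})) \<alpha>) - ?s (open_piece T T) \<alpha>)" for \<alpha>
  proof -
    have "(\<Sum>v\<in>V. ?s (vertex_cone v (convex hull V)) \<alpha>) =
        (\<Sum>v\<in>V. \<Sum>T\<in>{T \<in> ?\<T>. v \<in> T}. ?s (open_piece T (T - {v})) \<alpha>)"
      by (intro sum.cong refl cone)
    also have "\<dots> = (\<Sum>T\<in>?\<T>. \<Sum>v\<in>{v \<in> V. v \<in> T}. ?s (open_piece T (T - {v})) \<alpha>)"
      by (intro sum.swap_restrict finite_lex_faces) simp
    also have "\<dots> = (\<Sum>T\<in>?\<T>. \<Sum>v\<in>T. ?s (open_piece T (T - {v})) \<alpha>)"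
      by (intro sum.cong refl) (auto simp: lex_face_def)
    moreover have "?s (convex hull V) \<alpha> = (\<Sum>T\<in>?\<T>. ?s (open_piece T T) \<alpha>)"
      unfolding convex_hull_pieces(1)
      by (rule lattice_series_disjoint_union[OF finite_lex_faces convex_hull_pieces(2)])
    ultimately show ?thesis by (simp add: sum_subtractf)
  qed
  moreover have "L.torsion_series (\<lambda>\<alpha>. \<Sum>T\<in>?\<T>. (\<Sum>v\<in>T. ?s (open_piece T (T - {v})) \<alpha>) - ?s (open_piece T T) \<alpha>)"
    using open_simplex_brion[OF hom] by (intro L.torsion_series_sum) simp
  ultimately show ?thesis by simp
qed

end

theorem mainTheorem4:
  fixes \<phi> :: "int ^ 'd \<Rightarrow> 'g::ab_group_add"
    and P :: "(real ^ 'd) set"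
  assumes hom: "\<And>a b. \<phi> (a + b) = \<phi> a + \<phi> b"
    and "rational_polytope P"
  shows "loc_frac (denominators \<phi>)
      (laurent_transform \<phi> P :: ('d, ('g, 'r::comm_ring_1) group_ring) laurent) 1 =
    (\<Oplus>\<^bsub>localization (denominators \<phi>)\<^esub>v\<in>{v. v extreme_point_of P}.
      cone_transform \<phi> (vertex_cone v P))"
proof -
  from assms(2) obtain W where W: "finite W" "\<And>w. w \<in> W \<Longrightarrow> rational_vec w" "P = convex hull W"
    unfolding rational_polytope_def by blast
  have compact: "compact P" unfolding W(3) by (rule finite_imp_compact_convex_hull[OF W(1)])
  have sub: "{v. v extreme_point_of P} \<subseteq> W"
    unfolding W(3) using extreme_point_of_convex_hull by blast
  \<comment> \<open>Any enumeration of the vertices serves as the lexicographic order.\<close>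
  then obtain us where us: "set us = {v. v extreme_point_of P}"
    using finite_list finite_subset W(1) by metis
  have P: "P = convex hull (set us)"
    unfolding us using compact by (rule Krein_Milman_Minkowski) (simp add: W(3))
  have rational: "rational_vec v" if "v \<in> set us" for v using that us sub W(2) by auto
  \<comment> \<open>If \<open>v\<close> lay in the hull of the other vertices, that hull would be
    all of \<open>P\<close>; but extreme points of a hull are among its generating points.\<close>
  have extreme: "v \<notin> convex hull (set us - {v})" if "v \<in> set us" for v
  proof
    assume "v \<in> convex hull (set us - {v})"
    then have "convex hull (set us) = convex hull (set us - {v})"
      using hull_redundant[of v convex "set us - {v}"] that by (simp add: insert_absorb)
    then have eq: "convex hull (set us - {v}) = P" unfolding P by (rule sym)
    have "v extreme_point_of P" using that us by simp
    then show False
      using extreme_point_of_convex_hull[of v "set us - {v}"] unfolding eq by simp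
  qed
  from rational_common_denominator[OF List.finite_set rational] obtain N \<iota> where
    "0 < N" "\<And>v. v \<in> set us \<Longrightarrow> of_int_vec (\<iota> v) = real N *\<^sub>R v" by metis
  then interpret rational_lex_triangulation us N \<iota> by unfold_locales
  interpret L: laurent_localization
    "denominators \<phi> :: ('d, ('g, 'r::comm_ring_1) group_ring) laurent set"
    by (rule laurent_localization_denominators)
  let ?s = "\<lambda>Q. lattice_series \<phi> Q :: int ^ 'd \<Rightarrow> ('g, 'r) group_ring"
  have "L.has_fraction (?s (vertex_cone v P)) (cone_transform \<phi> (vertex_cone v P))" if "v \<in> V" for v
    unfolding P using that
    by (intro has_fraction_cone_transform[OF hom half_open_decomposition_vertex_cone] rational extreme)
  then have "L.has_fraction (\<lambda>\<alpha>. \<Sum>v\<in>V. ?s (vertex_cone v P) \<alpha>)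
      (\<Oplus>\<^bsub>localization (denominators \<phi>)\<^esub>v\<in>V. cone_transform \<phi> (vertex_cone v P))"
    by (intro L.has_fraction_finsum) simp_all
  moreover have "L.torsion_series (\<lambda>\<alpha>. (\<Sum>v\<in>V. ?s (vertex_cone v P) \<alpha>) - ?s P \<alpha>)"
    unfolding P by (rule torsion_vertex_cones_minus_polytope[OF hom extreme])
  \<comment> \<open>The sum of the cone transforms, a fraction of the summed cone series, is also
    one of the series of \<open>P\<close>, since the two series differ by torsion.\<close>
  ultimately have "L.has_fraction (?s P)
      (\<Oplus>\<^bsub>localization (denominators \<phi>)\<^esub>v\<in>V. cone_transform \<phi> (vertex_cone v P))"
    by (rule L.has_fraction_cong_torsion)
  \<comment> \<open>As \<open>P\<close> is bounded, its series is a Laurent polynomial and has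
    denominator \<open>1\<close>.\<close>
  moreover have "L.has_fraction (?s P) (loc_frac (denominators \<phi>) (laurent_transform \<phi> P) 1)"
    using L.has_fraction_lookup[of "laurent_transform \<phi> P"]
    by (simp add: lookup_laurent_transform compact_imp_bounded[OF compact])
  ultimately show ?thesis
    unfolding us[symmetric] using L.has_fraction_unique by blast
qed

end
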